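(* Let $(G,E,\sigma)$ be a contracting self-similar groupoid action where $E$ is a finite graph without sources. Then $\mathscr G_{(G,E)}$ is amenable. Moreover, if $H$ is the subgroupoid of $G$ generated by $G^0$ and the nucleus $\mathcal N$, then $(H,E,\sigma|_{H\times E})$ is a contracting self-similar groupoid action with $H$ finitely generated, and $\mathscr G_{(G,E)}\cong\mathscr G_{(H,E)}$.
   Context: Self-similar groupoid action $(G,E,\sigma)$: a directed graph with edge set $E$, vertex set $E^0$ and maps $r,s\colon E\to E^0$; a discrete groupoid $G$ with unit space $G^0=E^0$; a left action of $G$ on the set $E$ with anchor $r$ ($g(e)$ is defined when $s(g)=r(e)$, and $r(g(e))=r(g)$); and a map $\sigma\colon(g,e)\mapsto g|_e\in G$ (for $s(g)=r(e)$) with $r(g|_e)=s(g(e))$, $s(g|_e)=s(e)$, $(hg)|_e=h|_{g(e)}g|_e$. A path of length $n$ is $e_1\cdots e_n$ with $s(e_i)=r(e_{i+1})$; vertices are paths of length $0$; $E^+$ is the set of finite paths, $vE^+$ those with range $v$. Extend by $g(s(g))=r(g)$, $g|_{s(g)}=g$, $g(ep)=g(e)g|_e(p)$, $g|_{ep}=(g|_e)|_p$, and to infinite paths. The graph has no sources if $r^{-1}(v)\ne\emptyset$ for every vertex $v$. Contracting (for $E$ a finite graph without sources): there is a finite $F\subseteq G$ such that for all $g\in G$ there is $n\ge0$ with $g|_p\in F$ for all $p\in s(g)E^+$ of length at least $n$. The nucleus $\mathcal N$ is the unique smallest such $F$. Groupoid $\mathscr G_{(G,E)}$ (for $E$ finite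 without sources): $\partial E$ is the space of infinite paths with basis the cylinder sets $p\partial E$, $p\in E^+$. Let $S_{(G,E)}$ consist of $0$ and all triples $(p,g,q)$, $p,q\in E^+$, $g\in G$, $s(p)=r(g)$, $s(q)=s(g)$, with product $(p,g,q)(p',h,q')=(p\,g(t),g|_th,q')$ if $p'=qt$, $=(p,g\,h|_{h^{-1}(t)},q'h^{-1}(t))$ if $q=p't$, $0$ otherwise; nonzero idempotents are $(p,s(p),p)$. $(p,g,q)$ acts as the partial homeomorphism $q\partial E\to p\partial E$, $qw\mapsto p\,g(w)$. $\mathscr G_{(G,E)}$ is the étale groupoid of classes $[a,w]$, $w\in\mathrm{dom}(a)$, where $[a,w]=[b,w']$ iff $w=w'$ and $ae=be$ for some idempotent $e$ with $w\in\mathrm{dom}(e)$; $[a,b(w)][b,w]=[ab,w]$; basic open sets $\{[a,w]:w\in U\}$, $U\subseteq\mathrm{dom}(a)$ open. Amenability of a second countable (locally Hausdorff) étale groupoid $\mathscr H$ means topological amenability, equivalently Borel amenability: there are Borel functions $m_n\colon\mathscr H\to[0,\infty)$ with $\sum_{r(g)=x}m_n(g)\le1$ and $\to1$ for all units $x$, and $\sum_{r(g)=r(h)}|m_n(h^{-1}g)-m_n(g)|\to0$ for all $h\in\mathscr H$. *)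

theory Defs
  imports "HOL-Analysis.Analysis" "HOL-Library.Omega_Words_Fun" "Graph_Theory.Digraph"
begin

section \<open>Groupoids\<close>

text \<open>
  Groupoids are presented by their arrows only: a unit is an arrow, and \<open>src\<close>, \<open>rng\<close> take
  values in the units. The product \<open>mul G g h\<close> is meaningful when \<open>src G g = rng G h\<close>.
\<close>

record 'a groupoid =
  arr :: "'a set"
  src :: "'a \<Rightarrow> 'a"
  rng :: "'a \<Rightarrow> 'a"
  mul :: "'a \<Rightarrow> 'a \<Rightarrow> 'a"
  ginv :: "'a \<Rightarrow> 'a"

definition units :: "('a, 'm) groupoid_scheme \<Rightarrow> 'a set" where
  "units G = src G ` arr G"

locale groupoid =
  fixes G :: "('a, 'm) groupoid_scheme" (structure)
  assumes src_closed: "g \<in> arr G \<Longrightarrow> src G g \<in> arr G"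
    and rng_closed: "g \<in> arr G \<Longrightarrow> rng G g \<in> arr G"
    and src_src: "g \<in> arr G \<Longrightarrow> src G (src G g) = src G g"
    and rng_src: "g \<in> arr G \<Longrightarrow> rng G (src G g) = src G g"
    and src_rng: "g \<in> arr G \<Longrightarrow> src G (rng G g) = rng G g"
    and rng_rng: "g \<in> arr G \<Longrightarrow> rng G (rng G g) = rng G g"
    and mul_closed: "\<lbrakk>g \<in> arr G; h \<in> arr G; src G g = rng G h\<rbrakk> \<Longrightarrow> mul G g h \<in> arr G"
    and src_mul: "\<lbrakk>g \<in> arr G; h \<in> arr G; src G g = rng G h\<rbrakk> \<Longrightarrow> src G (mul G g h) = src G h"
    and rng_mul: "\<lbrakk>g \<in> arr G; h \<in> arr G; src G g = rng G h\<rbrakk> \<Longrightarrow> rng G (mul G g h) = rng G g"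
    and mul_assoc: "\<lbrakk>g \<in> arr G; h \<in> arr G; k \<in> arr G; src G g = rng G h; src G h = rng G k\<rbrakk>
        \<Longrightarrow> mul G (mul G g h) k = mul G g (mul G h k)"
    and mul_src: "g \<in> arr G \<Longrightarrow> mul G g (src G g) = g"
    and rng_mul_self: "g \<in> arr G \<Longrightarrow> mul G (rng G g) g = g"
    and ginv_closed: "g \<in> arr G \<Longrightarrow> ginv G g \<in> arr G"
    and src_ginv: "g \<in> arr G \<Longrightarrow> src G (ginv G g) = rng G g"
    and rng_ginv: "g \<in> arr G \<Longrightarrow> rng G (ginv G g) = src G g"
    and ginv_mul: "g \<in> arr G \<Longrightarrow> mul G (ginv G g) g = src G g"
    and mul_ginv: "g \<in> arr G \<Longrightarrow> mul G g (ginv G g) = rng G g"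

definition subgroupoid :: "'a set \<Rightarrow> ('a, 'm) groupoid_scheme \<Rightarrow> bool" where
  "subgroupoid K G \<longleftrightarrow> K \<subseteq> arr G \<and> (\<forall>g\<in>K. ginv G g \<in> K) \<and>
     (\<forall>g\<in>K. \<forall>h\<in>K. src G g = rng G h \<longrightarrow> mul G g h \<in> K)"

definition generated_subgroupoid :: "('a, 'm) groupoid_scheme \<Rightarrow> 'a set \<Rightarrow> 'a set" where
  "generated_subgroupoid G A = \<Inter> {K. subgroupoid K G \<and> A \<subseteq> K}"

definition finitely_generated :: "('a, 'm) groupoid_scheme \<Rightarrow> bool" where
  "finitely_generated G \<longleftrightarrow> (\<exists>A. finite A \<and> A \<subseteq> arr G \<and> generated_subgroupoid G A = arr G)"


section \<open>Topological groupoids\<close>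

record 'a top_groupoid = "'a groupoid" +
  gtop :: "'a topology"

definition top_groupoid_iso ::
    "('a, 'm) top_groupoid_scheme \<Rightarrow> ('b, 'n) top_groupoid_scheme \<Rightarrow> ('a \<Rightarrow> 'b) \<Rightarrow> bool" where
  "top_groupoid_iso G H \<phi> \<longleftrightarrow>
     bij_betw \<phi> (arr G) (arr H) \<and> homeomorphic_map (gtop G) (gtop H) \<phi> \<and>
     (\<forall>g\<in>arr G. src H (\<phi> g) = \<phi> (src G g) \<and> rng H (\<phi> g) = \<phi> (rng G g)) \<and>
     (\<forall>g\<in>arr G. \<forall>h\<in>arr G. src G g = rng G h \<longrightarrow> \<phi> (mul G g h) = mul H (\<phi> g) (\<phi> h))"

definition top_groupoid_isomorphic ::
    "('a, 'm) top_groupoid_scheme \<Rightarrow> ('b, 'n) top_groupoid_scheme \<Rightarrow> bool" where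
  "top_groupoid_isomorphic G H \<longleftrightarrow> (\<exists>\<phi>. top_groupoid_iso G H \<phi>)"

definition borel_groupoid :: "('a, 'm) top_groupoid_scheme \<Rightarrow> 'a measure" where
  "borel_groupoid G = sigma (topspace (gtop G)) {U. openin (gtop G) U}"

text \<open>
  Borel amenability, which for second countable etale groupoids is equivalent to topological
  amenability. Summability has to be demanded explicitly, as \<open>infsum\<close> is \<open>0\<close> for
  divergent sums; in the last condition it follows from the first one.
\<close>

definition amenable :: "('a, 'm) top_groupoid_scheme \<Rightarrow> bool" where
  "amenable G \<longleftrightarrow> (\<exists>m :: nat \<Rightarrow> 'a \<Rightarrow> real.
     (\<forall>n. m n \<in> borel_measurable (borel_groupoid G) \<and> (\<forall>g\<in>arr G. 0 \<le> m n g)) \<and>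
     (\<forall>x\<in>units G.
        (\<forall>n. m n summable_on {g \<in> arr G. rng G g = x} \<and>
             infsum (m n) {g \<in> arr G. rng G g = x} \<le> 1) \<and>
        (\<lambda>n. infsum (m n) {g \<in> arr G. rng G g = x}) \<longlonglongrightarrow> 1) \<and>
     (\<forall>h\<in>arr G.
        (\<lambda>n. \<Sum>\<^sub>\<infinity>g\<in>{g \<in> arr G. rng G g = rng G h}. \<bar>m n (mul G (ginv G h) g) - m n g\<bar>) \<longlonglongrightarrow> 0))"


section \<open>Self-similar groupoid actions\<close>

text \<open>
  For an edge \<open>e\<close>, its source is \<open>tail E e\<close> and its range is \<open>head E e\<close>. The vertices of the
  graph are literally the units of \<open>G\<close>. The value \<open>res g e\<close> is the restriction
  \<open>g|\<^sub>e\<close> given by the cocycle \<open>\<sigma>\<close>; both \<open>act g e\<close> and \<open>res g e\<close> are meaningful only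
  when \<open>src G g = head E e\<close>.

  A finite path is a pair \<open>(v, p)\<close> of its range \<open>v\<close> and its list of edges \<open>p\<close>, so that
  \<open>(v, [])\<close> is the vertex \<open>v\<close>. An infinite path is an \<open>\<omega>\<close>-word of edges.
\<close>

type_synonym ('g, 'e) path = "'g \<times> 'e list"

text \<open>Elements of the inverse semigroup; \<open>None\<close> is its zero.\<close>

type_synonym ('g, 'e) triple = "(('g, 'e) path \<times> 'g \<times> ('g, 'e) path) option"

text \<open>A germ is an equivalence class of pairs \<open>(a, w)\<close>.\<close>

type_synonym ('g, 'e) germ = "(('g, 'e) triple \<times> 'e word) set"

locale self_similar_action = groupoid G + wf_digraph E
  for G :: "'g groupoid" and E :: "('g, 'e) pre_digraph"
    and act :: "'g \<Rightarrow> 'e \<Rightarrow> 'e" and res :: "'g \<Rightarrow> 'e \<Rightarrow> 'g" +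
  assumes verts_eq_units: "verts E = units G"
    and act_closed: "\<lbrakk>g \<in> arr G; e \<in> arcs E; src G g = head E e\<rbrakk> \<Longrightarrow> act g e \<in> arcs E"
    and head_act: "\<lbrakk>g \<in> arr G; e \<in> arcs E; src G g = head E e\<rbrakk> \<Longrightarrow> head E (act g e) = rng G g"
    and act_unit: "e \<in> arcs E \<Longrightarrow> act (head E e) e = e"
    and act_mul: "\<lbrakk>h \<in> arr G; g \<in> arr G; e \<in> arcs E; src G h = rng G g; src G g = head E e\<rbrakk>
        \<Longrightarrow> act (mul G h g) e = act h (act g e)"
    and res_closed: "\<lbrakk>g \<in> arr G; e \<in> arcs E; src G g = head E e\<rbrakk> \<Longrightarrow> res g e \<in> arr G"
    and rng_res: "\<lbrakk>g \<in> arr G; e \<in> arcs E; src G g = head E e\<rbrakk>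
        \<Longrightarrow> rng G (res g e) = tail E (act g e)"
    and src_res: "\<lbrakk>g \<in> arr G; e \<in> arcs E; src G g = head E e\<rbrakk> \<Longrightarrow> src G (res g e) = tail E e"
    and res_mul: "\<lbrakk>h \<in> arr G; g \<in> arr G; e \<in> arcs E; src G h = rng G g; src G g = head E e\<rbrakk>
        \<Longrightarrow> res (mul G h g) e = mul G (res h (act g e)) (res g e)"
begin

primrec edge_path :: "'g \<Rightarrow> 'e list \<Rightarrow> bool" where
  "edge_path v [] \<longleftrightarrow> v \<in> verts E"
| "edge_path v (e # p) \<longleftrightarrow> e \<in> arcs E \<and> head E e = v \<and> edge_path (tail E e) p"

definition paths :: "('g, 'e) path set" where
  "paths = {(v, p). edge_path v p}"

fun path_src :: "('g, 'e) path \<Rightarrow> 'g" where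
  "path_src (v, p) = (if p = [] then v else tail E (last p))"

definition infinite_paths :: "'e word set" where
  "infinite_paths = {w. \<forall>n. w n \<in> arcs E \<and> tail E (w n) = head E (w (Suc n))}"

primrec act_path :: "'g \<Rightarrow> 'e list \<Rightarrow> 'e list" where
  "act_path g [] = []"
| "act_path g (e # p) = act g e # act_path (res g e) p"

primrec res_path :: "'g \<Rightarrow> 'e list \<Rightarrow> 'g" where
  "res_path g [] = g"
| "res_path g (e # p) = res_path (res g e) p"

definition act_infinite :: "'g \<Rightarrow> 'e word \<Rightarrow> 'e word" where
  "act_infinite g w = (\<lambda>n. act (res_path g (prefix n w)) (w n))"

definition no_sources :: bool where
  "no_sources \<longleftrightarrow> (\<forall>v\<in>verts E. \<exists>e\<in>arcs E. head E e = v)"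

definition contracting_core :: "'g set \<Rightarrow> bool" where
  "contracting_core F \<longleftrightarrow> finite F \<and> F \<subseteq> arr G \<and>
     (\<forall>g\<in>arr G. \<exists>n. \<forall>p. edge_path (src G g) p \<and> n \<le> length p \<longrightarrow> res_path g p \<in> F)"

definition contracting :: bool where
  "contracting \<longleftrightarrow> (\<exists>F. contracting_core F)"

definition nucleus :: "'g set" where
  "nucleus = (LEAST F. contracting_core F)"

definition nucleus_subgroupoid :: "'g groupoid" where
  "nucleus_subgroupoid = G\<lparr>arr := generated_subgroupoid G (units G \<union> nucleus)\<rparr>"


subsection \<open>The boundary and the inverse semigroup\<close>

definition cylinder :: "('g, 'e) path \<Rightarrow> 'e word set" where
  "cylinder p = {snd p \<frown> w | w. w \<in> infinite_paths \<and> path_src p = head E (w 0)}"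

definition boundary :: "'e word topology" where
  "boundary = topology_generated_by (cylinder ` paths)"

definition semigroup_elems :: "('g, 'e) triple set" where
  "semigroup_elems = insert None {Some (p, g, q) | p g q.
     p \<in> paths \<and> q \<in> paths \<and> g \<in> arr G \<and> path_src p = rng G g \<and> path_src q = src G g}"

fun append_path :: "('g, 'e) path \<Rightarrow> 'e list \<Rightarrow> ('g, 'e) path" where
  "append_path (v, p) t = (v, p @ t)"

fun extends :: "('g, 'e) path \<Rightarrow> ('g, 'e) path \<Rightarrow> bool" where
  "extends (v, p) (u, q) \<longleftrightarrow> v = u \<and> (\<exists>t. p = q @ t)"

fun semigroup_mult :: "('g, 'e) triple \<Rightarrow> ('g, 'e) triple \<Rightarrow> ('g, 'e) triple" where
  "semigroup_mult (Some (p, g, q)) (Some (p', h, q')) =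
     (if extends p' q then
        let t = drop (length (snd q)) (snd p')
        in Some (append_path p (act_path g t), mul G (res_path g t) h, q')
      else if extends q p' then
        let t = drop (length (snd p')) (snd q); t' = act_path (ginv G h) t
        in Some (p, mul G g (res_path h t'), append_path q' t')
      else None)"
| "semigroup_mult _ _ = None"

fun semigroup_inv :: "('g, 'e) triple \<Rightarrow> ('g, 'e) triple" where
  "semigroup_inv None = None"
| "semigroup_inv (Some (p, g, q)) = Some (q, ginv G g, p)"

definition idempotents :: "('g, 'e) triple set" where
  "idempotents = {e \<in> semigroup_elems. semigroup_mult e e = e}"

fun dom_of :: "('g, 'e) triple \<Rightarrow> 'e word set" where
  "dom_of None = {}"
| "dom_of (Some (p, g, q)) = cylinder q"

fun apply_triple :: "('g, 'e) triple \<Rightarrow> 'e word \<Rightarrow> 'e word" where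
  "apply_triple None w = w"
| "apply_triple (Some (p, g, q)) w = snd p \<frown> act_infinite g (suffix (length (snd q)) w)"


subsection \<open>The groupoid of germs\<close>

definition germ_pairs :: "(('g, 'e) triple \<times> 'e word) set" where
  "germ_pairs = {(a, w). a \<in> semigroup_elems \<and> w \<in> dom_of a}"

definition germ_rel :: "((('g, 'e) triple \<times> 'e word) \<times> (('g, 'e) triple \<times> 'e word)) set" where
  "germ_rel = {((a, w), (b, w')). (a, w) \<in> germ_pairs \<and> (b, w') \<in> germ_pairs \<and> w = w' \<and>
     (\<exists>e\<in>idempotents. w \<in> dom_of e \<and> semigroup_mult a e = semigroup_mult b e)}"

definition germ :: "('g, 'e) triple \<Rightarrow> 'e word \<Rightarrow> ('g, 'e) germ" where
  "germ a w = germ_rel `` {(a, w)}"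

definition germ_unit :: "'e word \<Rightarrow> ('g, 'e) germ" where
  "germ_unit w = (let v = head E (w 0) in germ (Some ((v, []), v, (v, []))) w)"

text \<open>
  The operations are defined on equivalence classes by taking the union over all
  representatives; all the members of each such union coincide.
\<close>

definition germ_groupoid :: "('g, 'e) germ top_groupoid" where
  "germ_groupoid = \<lparr>
     arr = germ_pairs // germ_rel,
     src = (\<lambda>X. \<Union>(a, w)\<in>X. germ_unit w),
     rng = (\<lambda>X. \<Union>(a, w)\<in>X. germ_unit (apply_triple a w)),
     mul = (\<lambda>X Y. \<Union> {germ (semigroup_mult a b) w | a b w.
                        (a, apply_triple b w) \<in> X \<and> (b, w) \<in> Y}),
     ginv = (\<lambda>X. \<Union>(a, w)\<in>X. germ (semigroup_inv a) (apply_triple a w)),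
     gtop = topology_generated_by
       {{germ a w | w. w \<in> U} | a U. a \<in> semigroup_elems \<and> openin boundary U \<and> U \<subseteq> dom_of a}\<rparr>"

text \<open>The smallest contracting core exists, so \<open>nucleus\<close> is what it should be.\<close>

lemma contracting_core_Int:
  assumes "contracting_core F" "contracting_core F'"
  shows "contracting_core (F \<inter> F')"
  unfolding contracting_core_def
proof (intro conjI ballI)
  fix g assume g: "g \<in> arr G"
  obtain n where n: "\<And>p. edge_path (src G g) p \<Longrightarrow> n \<le> length p \<Longrightarrow> res_path g p \<in> F"
    using assms(1) g unfolding contracting_core_def by blast
  obtain n' where n': "\<And>p. edge_path (src G g) p \<Longrightarrow> n' \<le> length p \<Longrightarrow> res_path g p \<in> F'"
    using assms(2) g unfolding contracting_core_def by blast
  show "\<exists>n. \<forall>p. edge_path (src G g) p \<and> n \<le> length p \<longrightarrow> res_path g p \<in> F \<inter> F'"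
    by (rule exI[of _ "max n n'"]) (use n n' in auto)
qed (use assms in \<open>auto simp: contracting_core_def\<close>)

lemma nucleus_least:
  assumes "contracting"
  shows "contracting_core nucleus" "contracting_core F \<Longrightarrow> nucleus \<subseteq> F"
proof -
  have "\<exists>N. contracting_core N \<and> (\<forall>F. contracting_core F \<longrightarrow> card N \<le> card F)"
    using assms ex_has_least_nat[of contracting_core _ card] unfolding contracting_def by blast
  then obtain N where N: "contracting_core N" "\<And>F. contracting_core F \<Longrightarrow> card N \<le> card F"
    by blast
  have le: "N \<subseteq> F" if "contracting_core F" for F
  proof -
    have "card N \<le> card (N \<inter> F)" using N contracting_core_Int that by blast
    moreover have "finite N" using N(1) by (simp add: contracting_core_def)
    ultimately have "N \<inter> F = N" by (meson Int_lower1 card_seteq)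
    then show ?thesis by blast
  qed
  have "nucleus = N" unfolding nucleus_def by (rule Least_equality) (use N(1) le in auto)
  then show "contracting_core nucleus" "contracting_core F \<Longrightarrow> nucleus \<subseteq> F"
    using N(1) le by auto
qed

end

locale contracting_self_similar_action =
  self_similar_action G E act res + fin_digraph E
  for G :: "'g groupoid" and E :: "('g, 'e) pre_digraph"
    and act :: "'g \<Rightarrow> 'e \<Rightarrow> 'e" and res :: "'g \<Rightarrow> 'e \<Rightarrow> 'g" +
  assumes no_sources: no_sources
    and contracting: contracting

end

(*
  Every germ with range x restricts to germs whose group coordinate lies in the finite symmetric
  set F formed by the nucleus, its inverses and the units. For amenability, move a path x to its
  k-th tail and apply a product of j elements of F. Such germs form sets T(k,j,x) whose sizes grow
  polynomially in j, because a product of j elements of F contracts into F after O(log j) letters.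
  A germ h from y to x of degree d maps T(k,j,y) into T(k+d,j+1,x) for all large k, and likewise
  for the inverse of h. Hence the averages over k, j <= n of the uniform distributions on T(k,j,x)
  are asymptotically invariant. They are Borel because each T(k,j) is a finite union of open
  bisections.

  The second part rests on the nucleus being closed under restriction, which follows from its
  minimality, so that the subgroupoid H it generates is self-similar. As every germ of G has a
  representative with coordinate in the nucleus, passing to H does not change the germ groupoid.
*)
theory Submission
  imports Defs "HOL-Real_Asymp.Real_Asymp"
begin

section \<open>A Foelner criterion for amenability\<close>

text \<open>Nothing is assumed about the growth or amenability of \<open>G\<close> itself. What is
  counted are germs: once the restriction at a deeper level lies in the finite core, a germ with
  given range is determined by a short prefix of its source point and one core element, however many
  arrows of \<open>G\<close> represent it. The two averages cure two different defects. For fixed k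
  the sets T(k,j) are moved to T(k+d,j+1), where the degree d is nonzero in general; the average
  over k turns this shift into a boundary effect. For fixed j, polynomial growth does not force a
  given quotient of successive sizes to be close to 1, but a telescoping sum of logarithms shows
  that most of them are. The germ groupoid need not be Hausdorff, so the means cannot be expected to
  be continuous. The cardinalities of the fibres are still Borel, because adding one bisection to a
  union changes them by the indicator of a difference of open sets.\<close>

lemma uniform_distributions_close:
  fixes A B P Q S :: "'a set"
  assumes "finite S" "finite Q" "P \<subseteq> A" "P \<subseteq> B" "A \<subseteq> Q" "B \<subseteq> Q" "A \<noteq> {}" "B \<noteq> {}"
  shows "(\<Sum>g\<in>S. \<bar>of_bool (g \<in> A) / real (card A) - of_bool (g \<in> B) / real (card B)\<bar>)
    \<le> 2 * (1 - real (card P) / real (card Q))"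
proof -
  define a b where "a g = of_bool (g \<in> A) / real (card A)" and "b g = of_bool (g \<in> B) / real (card B)" for g
  have fin: "finite A" "finite B" "finite P" "finite (S \<union> Q)"
    using assms finite_subset[of _ Q] finite_subset[of P A] by auto
  have pos: "card A > 0" "card B > 0" using fin assms by (auto simp: card_gt_0_iff)
  have sum_a: "sum a (S \<union> Q) = 1"
  proof -
    have "sum a (S \<union> Q) = (\<Sum>g\<in>A. 1 / real (card A))"
      unfolding a_def by (rule sum.mono_neutral_cong_right) (use fin assms in auto)
    then show ?thesis using pos by simp
  qed
  have sum_b: "sum b (S \<union> Q) = 1"
  proof -
    have "sum b (S \<union> Q) = (\<Sum>g\<in>B. 1 / real (card B))"
      unfolding b_def by (rule sum.mono_neutral_cong_right) (use fin assms in auto)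
    then show ?thesis using pos by simp
  qed
  \<comment> \<open>On \<open>P\<close> both densities are at least 1 / card Q, so their minimum has
    mass at least card P / card Q.\<close>
  have "card A \<le> card Q" "card B \<le> card Q" using assms by (auto intro: card_mono)
  then have "1 / real (card Q) \<le> min (a g) (b g)" if "g \<in> P" for g
    using that assms pos by (auto simp: a_def b_def frac_le)
  then have "(\<Sum>g\<in>P. 1 / real (card Q)) \<le> (\<Sum>g\<in>P. min (a g) (b g))" by (rule sum_mono)
  also have "\<dots> \<le> (\<Sum>g\<in>S \<union> Q. min (a g) (b g))"
    by (rule sum_mono2) (use fin assms in \<open>auto simp: a_def b_def\<close>)
  finally have min: "real (card P) / real (card Q) \<le> (\<Sum>g\<in>S \<union> Q. min (a g) (b g))" by simp
  \<comment> \<open>\<open>S\<close> need not contain the supports. Over \<open>S \<union> Q\<close>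
    both masses are 1, and the distance is 2 minus twice the mass of the minimum.\<close>
  have "(\<Sum>g\<in>S. \<bar>a g - b g\<bar>) \<le> (\<Sum>g\<in>S \<union> Q. \<bar>a g - b g\<bar>)"
    by (rule sum_mono2) (use fin in auto)
  also have "\<dots> = (\<Sum>g\<in>S \<union> Q. a g + b g - 2 * min (a g) (b g))"
    by (rule sum.cong) auto
  also have "\<dots> = 2 - 2 * (\<Sum>g\<in>S \<union> Q. min (a g) (b g))"
    by (simp add: sum_subtractf sum.distrib sum_a sum_b sum_distrib_left)
  also have "\<dots> \<le> 2 * (1 - real (card P) / real (card Q))" using min by simp
  finally show ?thesis unfolding a_def b_def .
qed

lemma sum_one_minus_ratio_le:
  fixes q :: "nat \<Rightarrow> real"
  assumes "\<And>n. 1 \<le> q n"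
  shows "(\<Sum>j<n. 1 - q j / q (j + 2)) \<le> ln (q (n + 1)) + ln (q n)"
proof -
  have pos: "0 < q n" for n using assms[of n] by linarith
  have "(\<Sum>j<n. 1 - q j / q (j + 2)) \<le> ln (q (n + 1)) + ln (q n) - ln (q 1) - ln (q 0)"
  proof (induction n)
    case (Suc n)
    have "ln (q n / q (n + 2)) \<le> q n / q (n + 2) - 1"
      by (rule ln_le_minus_one) (use pos in simp)
    then have "1 - q n / q (n + 2) \<le> ln (q (n + 2)) - ln (q n)"
      using pos[of n] pos[of "n + 2"] by (simp add: ln_div split: if_splits)
    with Suc show ?case by simp
  qed simp
  moreover have "0 \<le> ln (q 1)" "0 \<le> ln (q 0)" using assms by auto
  ultimately show ?thesis by linarith
qed

text \<open>Moving a window of length \<open>N\<close> by \<open>a\<close> only exchanges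
  \<open>a\<close> terms at its beginning for \<open>a\<close> terms behind its end. All terms being
  nonnegative, these boundary terms may simply be added up.\<close>

lemma sum_diff_shift_le:
  fixes U V :: "nat \<Rightarrow> real"
  assumes "\<And>k. 0 \<le> U k" "\<And>k. 0 \<le> V k"
  shows "\<bar>(\<Sum>k<N. U k) - (\<Sum>k<N. V k)\<bar> \<le> (\<Sum>k<N. \<bar>U (k + a) - V (k + b)\<bar>)
    + (\<Sum>k<a. U k + U (k + N)) + (\<Sum>k<b. V k + V (k + N))"
proof -
  have shift: "(\<Sum>k<N. W k) = (\<Sum>k<N. W (k + a)) + (\<Sum>k<a. W k) - (\<Sum>k<a. W (k + N))"
    for W :: "nat \<Rightarrow> real" and a
  proof -
    have *: "(\<Sum>k<m + l. W k) = (\<Sum>k<m. W k) + (\<Sum>k<l. W (k + m))" for m l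
      by (induction l) (auto simp: add.commute)
    show ?thesis using *[of N a] *[of a N] by (simp add: add.commute)
  qed
  have "\<bar>(\<Sum>k<N. U (k + a)) - (\<Sum>k<N. V (k + b))\<bar> \<le> (\<Sum>k<N. \<bar>U (k + a) - V (k + b)\<bar>)"
    unfolding sum_subtractf[symmetric] by (rule sum_abs)
  moreover have "0 \<le> (\<Sum>k<a. U k)" "0 \<le> (\<Sum>k<a. U (k + N))" "0 \<le> (\<Sum>k<b. V k)" "0 \<le> (\<Sum>k<b. V (k + N))"
    using assms by (auto intro: sum_nonneg)
  ultimately show ?thesis
    unfolding shift[of U a] shift[of V b] sum.distrib by linarith
qed

section \<open>Elementary algebra in a groupoid\<close>

context groupoid
begin

lemma mul_left_cancel:
  assumes "h \<in> arr G" "g \<in> arr G" "rng G g = src G h"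
  shows "mul G (ginv G h) (mul G h g) = g"
  using assms mul_assoc[of "ginv G h" h g] ginv_closed[of h] src_ginv[of h] ginv_mul[of h]
    rng_mul_self[of g] by simp

lemma mul_left_cancel':
  assumes "h \<in> arr G" "g \<in> arr G" "rng G g = rng G h"
  shows "mul G h (mul G (ginv G h) g) = g"
  using assms mul_assoc[of h "ginv G h" g] ginv_closed[of h] src_ginv[of h] rng_ginv[of h]
    mul_ginv[of h] rng_mul_self[of g] by simp

lemma ginv_unique:
  assumes "g \<in> arr G" "h \<in> arr G" "src G h = rng G g" "mul G h g = src G g"
  shows "h = ginv G g"
proof -
  have "h = mul G h (mul G g (ginv G g))" using assms mul_src[of h] mul_ginv[of g] by simp
  also have "\<dots> = mul G (src G g) (ginv G g)"
    using assms mul_assoc[of h g "ginv G g"] ginv_closed[of g] rng_ginv[of g] by simp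
  also have "\<dots> = ginv G g" using assms rng_mul_self[of "ginv G g"] ginv_closed rng_ginv by simp
  finally show ?thesis .
qed

lemma ginv_ginv: "g \<in> arr G \<Longrightarrow> ginv G (ginv G g) = g"
  using ginv_unique[of "ginv G g" g] by (simp add: ginv_closed src_ginv rng_ginv mul_ginv)

lemma idem_imp_unit:
  assumes "g \<in> arr G" "src G g = rng G g" "mul G g g = g"
  shows "g = src G g"
  using assms mul_left_cancel[of g g] ginv_mul[of g] by simp

lemma units_arr: "u \<in> units G \<Longrightarrow> u \<in> arr G"
  by (auto simp: units_def src_closed)

lemma src_unit: "u \<in> units G \<Longrightarrow> src G u = u"
  by (auto simp: units_def src_src)

lemma rng_unit: "u \<in> units G \<Longrightarrow> rng G u = u"
  by (auto simp: units_def rng_src)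

lemma src_in_units: "g \<in> arr G \<Longrightarrow> src G g \<in> units G"
  by (auto simp: units_def)

lemma rng_in_units: "g \<in> arr G \<Longrightarrow> rng G g \<in> units G"
  using src_rng[of g] rng_closed[of g] by (auto simp: units_def intro!: image_eqI[of _ _ "rng G g"])

lemma ginv_unit: "u \<in> units G \<Longrightarrow> ginv G u = u"
  using ginv_unique[of u u] units_arr src_unit rng_unit mul_src[of u] by metis

end

text \<open>
  The invariant means average the uniform distributions on the fibres of \<open>T k j\<close> over
  \<open>k, j \<le> n\<close>. Averaging over \<open>j\<close> is a Foelner argument: as the fibres of \<open>T k j\<close> grow
  subexponentially in \<open>j\<close>, most of the quotients \<open>q j / q (j + 2)\<close> of their sizes are close
  to \<open>1\<close>. Averaging over \<open>k\<close> absorbs the shift from \<open>a\<close> to \<open>b\<close>.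
\<close>

lemma amenable_of_subexponential_growth:
  fixes G :: "('a, 'm) top_groupoid_scheme" and T :: "nat \<Rightarrow> nat \<Rightarrow> 'a set" and f :: "nat \<Rightarrow> real"
  assumes "groupoid G"
    and T_sets: "\<And>k j. T k j \<in> sets (borel_groupoid G)"
    and T_arr: "\<And>k j g. g \<in> T k j \<Longrightarrow> g \<in> arr G"
    and card_meas: "\<And>k j. (\<lambda>g. real (card {t \<in> T k j. rng G t = rng G g}))
          \<in> borel_measurable (borel_groupoid G)"
    and fin: "\<And>k j x. x \<in> units G \<Longrightarrow> finite {t \<in> T k j. rng G t = x}"
    and ne: "\<And>k j x. x \<in> units G \<Longrightarrow> {t \<in> T k j. rng G t = x} \<noteq> {}"
    and growth: "\<And>k j x. x \<in> units G \<Longrightarrow> real (card {t \<in> T k j. rng G t = x}) \<le> f j"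
    and f: "(\<lambda>n. ln (f n) / n) \<longlonglongrightarrow> 0"
    and mono: "\<And>k j. T k j \<subseteq> T k (Suc j)"
    and translate: "\<And>h. h \<in> arr G \<Longrightarrow> \<exists>a b. \<forall>k j.
          (\<forall>g\<in>T (k + a) j. rng G g = src G h \<longrightarrow> mul G h g \<in> T (k + b) (Suc j)) \<and>
          (\<forall>g\<in>T (k + b) j. rng G g = rng G h \<longrightarrow> mul G (ginv G h) g \<in> T (k + a) (Suc j))"
  shows "amenable G"
proof -
  interpret groupoid G by fact
  define F where "F k j x = {t \<in> T k j. rng G t = x}" for k j x
  define \<mu> where "\<mu> k j g = of_bool (g \<in> T k j) / real (card (F k j (rng G g)))" for k j g
  define m where "m n g = (\<Sum>k<Suc n. \<Sum>j<Suc n. \<mu> k j g) / (real (Suc n))\<^sup>2" for n g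
  have F: "finite (F k j x)" "F k j x \<noteq> {}" "card (F k j x) \<le> f j" if "x \<in> units G" for k j x
    using fin ne growth that unfolding F_def by auto
  have card_F: "card (F k j x) > 0" if "x \<in> units G" for k j x
    using F that by (simp add: card_gt_0_iff)
  have \<mu>_nonneg: "0 \<le> \<mu> k j g" for k j g by (simp add: \<mu>_def)
  have \<mu>_F: "\<mu> k j g = of_bool (g \<in> F k j x) / card (F k j x)" if "rng G g = x" for k j g x
    using that by (auto simp: \<mu>_def F_def)
  have m_nonneg: "0 \<le> m n g" for n g
    unfolding m_def by (intro divide_nonneg_nonneg sum_nonneg) (auto simp: \<mu>_nonneg)
  have m_meas: "m n \<in> borel_measurable (borel_groupoid G)" for n
  proof -
    have "\<mu> k j \<in> borel_measurable (borel_groupoid G)" for k j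
    proof -
      have "(\<lambda>g. indicator (T k j) g / real (card (F k j (rng G g)))) \<in> borel_measurable (borel_groupoid G)"
        unfolding F_def using T_sets card_meas by measurable
      then show ?thesis unfolding \<mu>_def by (simp add: indicator_def of_bool_def cong: if_cong)
    qed
    then show ?thesis unfolding m_def by measurable
  qed
  \<comment> \<open>As no fibre is empty, every \<open>\<mu> k j\<close> has mass 1 on each fibre,
    and so has their average: the required limit is attained for every \<open>n\<close>.\<close>
  have m_sum: "m n summable_on {g \<in> arr G. rng G g = x} \<and> infsum (m n) {g \<in> arr G. rng G g = x} = 1"
    if x: "x \<in> units G" for n x
  proof -
    define S where "S = (\<Union>k<Suc n. \<Union>j<Suc n. F k j x)"
    have S: "finite S" "S \<subseteq> {g \<in> arr G. rng G g = x}"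
      using F(1)[OF x] T_arr by (auto simp: S_def F_def)
    have zero: "m n g = 0" if "g \<in> {g \<in> arr G. rng G g = x} - S" for g
    proof -
      have "\<mu> k j g = 0" if "k < Suc n" "j < Suc n" for k j
        using that \<open>g \<in> _\<close> by (auto simp: S_def \<mu>_F[of g x])
      then show ?thesis by (simp add: m_def)
    qed
    have *: "(m n has_sum a) S \<longleftrightarrow> (m n has_sum a) {g \<in> arr G. rng G g = x}" for a
      by (rule has_sum_cong_neutral) (use S zero in auto)
    have \<mu>_sum: "(\<Sum>g\<in>S. \<mu> k j g) = 1" if "k < Suc n" "j < Suc n" for k j
    proof -
      have "F k j x \<subseteq> S" using that by (auto simp: S_def)
      then have "(\<Sum>g\<in>S. \<mu> k j g) = (\<Sum>g\<in>F k j x. 1 / card (F k j x))"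
        by (intro sum.mono_neutral_cong_right) (use S in \<open>auto simp: \<mu>_F[of _ x] subset_iff\<close>)
      then show ?thesis using card_F[OF x, of k j] by simp
    qed
    have "(\<Sum>g\<in>S. m n g) = (\<Sum>k<Suc n. \<Sum>j<Suc n. \<Sum>g\<in>S. \<mu> k j g) / (real (Suc n))\<^sup>2"
      unfolding m_def sum_divide_distrib[symmetric]
      by (subst sum.swap, subst sum.swap[of _ S]) (rule refl)
    also have "\<dots> = 1"
      by (simp add: \<mu>_sum power2_eq_square del: sum.lessThan_Suc)
    finally have "(m n has_sum 1) S" using has_sum_finite[OF S(1), of "m n"] by simp
    then have "(m n has_sum 1) {g \<in> arr G. rng G g = x}" using * by simp
    then show ?thesis by (auto simp: has_sum_imp_summable infsumI)
  qed
  have m_inv: "(\<lambda>n. \<Sum>\<^sub>\<infinity>g\<in>{g \<in> arr G. rng G g = rng G h}. \<bar>m n (mul G (ginv G h) g) - m n g\<bar>) \<longlonglongrightarrow> 0"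
    if h: "h \<in> arr G" for h
  proof -
    define x y where "x = rng G h" and "y = src G h"
    define X where "X = {g \<in> arr G. rng G g = x}"
    have xy: "x \<in> units G" "y \<in> units G" using h by (auto simp: x_def y_def rng_in_units src_in_units)
    define \<tau> where "\<tau> g = mul G (ginv G h) g" for g
    have \<tau>: "\<tau> g \<in> arr G" "rng G (\<tau> g) = y" "mul G h (\<tau> g) = g" if "g \<in> X" for g
      using that h mul_left_cancel'[of h g]
      by (auto simp: \<tau>_def X_def x_def y_def mul_closed ginv_closed src_ginv rng_ginv rng_mul)
    have \<tau>_surj: "mul G h g \<in> X" "\<tau> (mul G h g) = g" if "g \<in> arr G" "rng G g = y" for g
      using that h mul_left_cancel[of h g] by (auto simp: \<tau>_def X_def x_def y_def mul_closed rng_mul)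
    \<comment> \<open>\<open>B k j\<close> is the left translate by \<open>h\<close> of the fibre of
      \<open>T k j\<close> over \<open>y\<close>, so composing \<open>\<mu> k j\<close> with
      \<open>\<tau>\<close> gives the uniform density on it.\<close>
    define B where "B k j = {g \<in> X. \<tau> g \<in> F k j y}" for k j
    have bij: "bij_betw \<tau> (B k j) (F k j y)" for k j
    proof (rule bij_betwI')
      fix t assume "t \<in> F k j y"
      then have "t \<in> arr G" "rng G t = y" using T_arr by (auto simp: F_def)
      then show "\<exists>g\<in>B k j. t = \<tau> g" using \<tau>_surj \<open>t \<in> F k j y\<close> by (intro bexI[of _ "mul G h t"]) (auto simp: B_def)
    qed (use \<tau>(3) in \<open>auto simp: B_def, metis\<close>)
    have B: "finite (B k j)" "card (B k j) = card (F k j y)" "B k j \<noteq> {}" for k j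
      using bij_betw_finite[OF bij] bij_betw_same_card[OF bij] F(1,2)[OF xy(2), of k j] bij[of k j]
      by (auto simp: bij_betw_def)
    have \<mu>_B: "\<mu> k j (\<tau> g) = of_bool (g \<in> B k j) / card (B k j)" if "g \<in> X" for k j g
      using that B(2)[of k j] \<mu>_F[OF \<tau>(2)[OF that]] by (simp add: B_def)
    obtain a b where ab: "\<And>k j g. g \<in> T (k + a) j \<Longrightarrow> rng G g = y \<Longrightarrow> mul G h g \<in> T (k + b) (Suc j)"
       "\<And>k j g. g \<in> T (k + b) j \<Longrightarrow> rng G g = x \<Longrightarrow> \<tau> g \<in> T (k + a) (Suc j)"
      using translate[OF h] unfolding x_def y_def \<tau>_def by metis
    have F_mono: "F k j z \<subseteq> F k (Suc j) z" for k j z using mono by (auto simp: F_def)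
    \<comment> \<open>Translating by \<open>h\<close> raises the second index by one, and so does
      translating back. Hence \<open>F (k + b) j x\<close> and \<open>F (k + b) (j + 2) x\<close>
      enclose both sets to be compared, which is where the quotients with step two come
      from.\<close>
    have close: "(\<Sum>g\<in>S. \<bar>\<mu> (k + a) (Suc j) (\<tau> g) - \<mu> (k + b) (Suc j) g\<bar>)
      \<le> 2 * (1 - card (F (k + b) j x) / card (F (k + b) (j + 2) x))"
      if S: "finite S" "S \<subseteq> X" for S k j
    proof -
      have "(\<Sum>g\<in>S. \<bar>\<mu> (k + a) (Suc j) (\<tau> g) - \<mu> (k + b) (Suc j) g\<bar>)
        = (\<Sum>g\<in>S. \<bar>of_bool (g \<in> B (k + a) (Suc j)) / card (B (k + a) (Suc j))
             - of_bool (g \<in> F (k + b) (Suc j) x) / card (F (k + b) (Suc j) x)\<bar>)"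
        by (rule sum.cong) (use S in \<open>auto simp: \<mu>_B subset_iff \<mu>_F[of _ x] X_def\<close>)
      also have "\<dots> \<le> 2 * (1 - card (F (k + b) j x) / card (F (k + b) (j + 2) x))"
      proof (rule uniform_distributions_close)
        show "F (k + b) j x \<subseteq> B (k + a) (Suc j)"
        proof
          fix g assume "g \<in> F (k + b) j x"
          then have g: "g \<in> X" "\<tau> g \<in> T (k + a) (Suc j)"
            using ab(2) T_arr by (auto simp: F_def X_def)
          then show "g \<in> B (k + a) (Suc j)" using \<tau>(2) by (simp add: B_def F_def)
        qed
        show "B (k + a) (Suc j) \<subseteq> F (k + b) (j + 2) x"
          using ab(1)[of _ k "Suc j"] \<tau>(3) by (fastforce simp: B_def X_def F_def)
        show "F (k + b) (Suc j) x \<subseteq> F (k + b) (j + 2) x" using F_mono[of _ "Suc j"] by simp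
      qed (use S B F[OF xy(1)] F_mono in auto)
      finally show ?thesis .
    qed
    have sum_le1: "(\<Sum>g\<in>S. \<mu> k j g) \<le> 1" "(\<Sum>g\<in>S. \<mu> k j (\<tau> g)) \<le> 1"
      if S: "finite S" "S \<subseteq> X" for S k j
    proof -
      have "(\<Sum>g\<in>S. \<mu> k j g) = (\<Sum>g\<in>S \<inter> F k j x. 1 / card (F k j x))"
        by (rule sum.mono_neutral_cong_right) (use S in \<open>auto simp: \<mu>_F[of _ x] X_def\<close>)
      also have "\<dots> \<le> (\<Sum>g\<in>F k j x. 1 / card (F k j x))"
        by (rule sum_mono2) (use F(1)[OF xy(1)] in auto)
      also have "\<dots> = 1" using card_F[OF xy(1), of k j] by simp
      finally show "(\<Sum>g\<in>S. \<mu> k j g) \<le> 1" .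
      have "(\<Sum>g\<in>S. \<mu> k j (\<tau> g)) = (\<Sum>g\<in>S \<inter> B k j. 1 / card (B k j))"
        by (rule sum.mono_neutral_cong_right) (use S in \<open>auto simp: \<mu>_B subset_iff\<close>)
      also have "\<dots> \<le> (\<Sum>g\<in>B k j. 1 / card (B k j))"
        by (rule sum_mono2) (use B(1) in auto)
      also have "\<dots> = 1" using card_F[OF xy(2), of k j] B(2) by simp
      finally show "(\<Sum>g\<in>S. \<mu> k j (\<tau> g)) \<le> 1" .
    qed
    \<comment> \<open>The sandwich estimate starts at \<open>Suc j\<close>, so j = 0 is bounded
      separately by the two masses; this gives the 2. The factor 4 is the 2 of the distance estimate
      times the two surviving logarithms.\<close>
    have row: "(\<Sum>j<N. \<Sum>g\<in>S. \<bar>\<mu> (k + a) j (\<tau> g) - \<mu> (k + b) j g\<bar>) \<le> 2 + 4 * ln (f (Suc N))"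
      if S: "finite S" "S \<subseteq> X" for S k N
    proof -
      define q where "q j = real (card (F (k + b) j x))" for j
      have q: "1 \<le> q j" "q j \<le> f j" for j
        using card_F[OF xy(1), of "k + b" j] F(3)[OF xy(1), of "k + b" j] by (auto simp: q_def)
      have "q N \<le> q (Suc N)"
        unfolding q_def using F_mono F(1)[OF xy(1)] by (simp add: card_mono)
      then have qln: "ln (q N) \<le> ln (f (Suc N))" "ln (q (N + 1)) \<le> ln (f (Suc N))"
        using q[of N] q[of "Suc N"] by (auto intro!: ln_mono)
      define d where "d j = (\<Sum>g\<in>S. \<bar>\<mu> (k + a) j (\<tau> g) - \<mu> (k + b) j g\<bar>)" for j
      have d0: "d 0 \<le> 2"
      proof -
        have "d 0 \<le> (\<Sum>g\<in>S. \<mu> (k + a) 0 (\<tau> g) + \<mu> (k + b) 0 g)"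
          unfolding d_def using \<mu>_nonneg by (intro sum_mono) (smt (verit))
        also have "\<dots> \<le> 2" using sum_le1[OF S, of "k + b" 0] sum_le1(2)[OF S, of "k + a" 0] by (simp add: sum.distrib)
        finally show ?thesis .
      qed
      have "d j \<ge> 0" for j unfolding d_def by (simp add: sum_nonneg)
      then have "(\<Sum>j<N. d j) \<le> (\<Sum>j<Suc N. d j)" by simp
      also have "\<dots> = d 0 + (\<Sum>j<N. d (Suc j))" by (rule sum.lessThan_Suc_shift)
      also have "(\<Sum>j<N. d (Suc j)) \<le> (\<Sum>j<N. 2 * (1 - q j / q (j + 2)))"
        unfolding d_def q_def by (rule sum_mono) (rule close[OF S])
      also have "\<dots> = 2 * (\<Sum>j<N. 1 - q j / q (j + 2))" by (rule sum_distrib_left[symmetric])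
      also have "\<dots> \<le> 2 * (ln (q (N + 1)) + ln (q N))"
        using sum_one_minus_ratio_le[of q N] q(1) by simp
      finally show ?thesis using d0 qln unfolding d_def by simp
    qed
    \<comment> \<open>The 2 stems from j = 0. Each of the a + b boundary indices contributes two
      sums of at most N, and the common factor N cancels against one of the two in the normalisation
      of \<open>m\<close>.\<close>
    define C where "C = 2 + 2 * real a + 2 * real b"
    have bound: "(\<Sum>\<^sub>\<infinity>g\<in>X. \<bar>m n (\<tau> g) - m n g\<bar>) \<le> (C + 4 * ln (f (n + 2))) / real (Suc n)" for n
    proof -
      define N where "N = Suc n"
      define S where "S = (\<Union>k<N. \<Union>j<N. F k j x \<union> B k j)"
      have S: "finite S" "S \<subseteq> X"
        using F(1)[OF xy(1)] B(1) T_arr by (auto simp: S_def F_def B_def X_def)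
      have zero: "\<bar>m n (\<tau> g) - m n g\<bar> = 0" if "g \<in> X - S" for g
      proof -
        have "\<mu> k j g = 0 \<and> \<mu> k j (\<tau> g) = 0" if "k < N" "j < N" for k j
          using that \<open>g \<in> _\<close> by (auto simp: S_def \<mu>_F[of g x] \<mu>_B X_def)
        then show ?thesis by (simp add: m_def N_def)
      qed
      have "(\<Sum>\<^sub>\<infinity>g\<in>X. \<bar>m n (\<tau> g) - m n g\<bar>) = (\<Sum>\<^sub>\<infinity>g\<in>S. \<bar>m n (\<tau> g) - m n g\<bar>)"
        by (rule infsum_cong_neutral) (use S zero in auto)
      also have "\<dots> = (\<Sum>g\<in>S. \<bar>m n (\<tau> g) - m n g\<bar>)" using S by simp
      finally have eq: "(\<Sum>\<^sub>\<infinity>g\<in>X. \<bar>m n (\<tau> g) - m n g\<bar>) = (\<Sum>g\<in>S. \<bar>m n (\<tau> g) - m n g\<bar>)" .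
      define U V where "U g k = (\<Sum>j<N. \<mu> k j (\<tau> g))" and "V g k = (\<Sum>j<N. \<mu> k j g)" for g k
      have UV: "0 \<le> U g k" "0 \<le> V g k" for g k
        by (auto simp: U_def V_def intro!: sum_nonneg \<mu>_nonneg)
      have UVS: "(\<Sum>g\<in>S. U g k) \<le> N" "(\<Sum>g\<in>S. V g k) \<le> N" for k
      proof -
        have "(\<Sum>g\<in>S. U g k) = (\<Sum>j<N. \<Sum>g\<in>S. \<mu> k j (\<tau> g))" unfolding U_def by (rule sum.swap)
        also have "\<dots> \<le> (\<Sum>j<N. 1)" by (rule sum_mono) (rule sum_le1(2)[OF S])
        finally show "(\<Sum>g\<in>S. U g k) \<le> N" by simp
        have "(\<Sum>g\<in>S. V g k) = (\<Sum>j<N. \<Sum>g\<in>S. \<mu> k j g)" unfolding V_def by (rule sum.swap)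
        also have "\<dots> \<le> (\<Sum>j<N. 1)" by (rule sum_mono) (rule sum_le1(1)[OF S])
        finally show "(\<Sum>g\<in>S. V g k) \<le> N" by simp
      qed
      have "(real N)\<^sup>2 * (\<Sum>g\<in>S. \<bar>m n (\<tau> g) - m n g\<bar>) = (\<Sum>g\<in>S. \<bar>(\<Sum>k<N. U g k) - (\<Sum>k<N. V g k)\<bar>)"
        unfolding sum_distrib_left
      proof (rule sum.cong)
        fix g
        have "m n (\<tau> g) - m n g = ((\<Sum>k<N. U g k) - (\<Sum>k<N. V g k)) / (real N)\<^sup>2"
          unfolding m_def U_def V_def N_def diff_divide_distrib ..
        then show "(real N)\<^sup>2 * \<bar>m n (\<tau> g) - m n g\<bar> = \<bar>(\<Sum>k<N. U g k) - (\<Sum>k<N. V g k)\<bar>"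
          by (simp add: N_def abs_divide)
      qed simp
      also have "\<dots> \<le> (\<Sum>g\<in>S. (\<Sum>k<N. \<bar>U g (k + a) - V g (k + b)\<bar>)
          + (\<Sum>k<a. U g k + U g (k + N)) + (\<Sum>k<b. V g k + V g (k + N)))"
        by (rule sum_mono) (rule sum_diff_shift_le, rule UV, rule UV)
      also have "\<dots> = (\<Sum>k<N. \<Sum>g\<in>S. \<bar>U g (k + a) - V g (k + b)\<bar>)
          + (\<Sum>k<a. (\<Sum>g\<in>S. U g k) + (\<Sum>g\<in>S. U g (k + N)))
          + (\<Sum>k<b. (\<Sum>g\<in>S. V g k) + (\<Sum>g\<in>S. V g (k + N)))"
        unfolding sum.distrib
        by (simp only: sum.swap[of _ S "{..<N}"] sum.swap[of _ S "{..<a}"] sum.swap[of _ S "{..<b}"])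
      also have "(\<Sum>k<a. (\<Sum>g\<in>S. U g k) + (\<Sum>g\<in>S. U g (k + N))) \<le> (\<Sum>k<a. real N + real N)"
        by (intro sum_mono add_mono UVS)
      also have "(\<Sum>k<b. (\<Sum>g\<in>S. V g k) + (\<Sum>g\<in>S. V g (k + N))) \<le> (\<Sum>k<b. real N + real N)"
        by (intro sum_mono add_mono UVS)
      also have "(\<Sum>k<N. \<Sum>g\<in>S. \<bar>U g (k + a) - V g (k + b)\<bar>) \<le> (\<Sum>k<N. 2 + 4 * ln (f (Suc N)))"
      proof (rule sum_mono)
        fix k
        have "(\<Sum>g\<in>S. \<bar>U g (k + a) - V g (k + b)\<bar>)
          \<le> (\<Sum>g\<in>S. \<Sum>j<N. \<bar>\<mu> (k + a) j (\<tau> g) - \<mu> (k + b) j g\<bar>)"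
          unfolding U_def V_def sum_subtractf[symmetric] by (rule sum_mono) (rule sum_abs)
        also have "\<dots> = (\<Sum>j<N. \<Sum>g\<in>S. \<bar>\<mu> (k + a) j (\<tau> g) - \<mu> (k + b) j g\<bar>)" by (rule sum.swap)
        also have "\<dots> \<le> 2 + 4 * ln (f (Suc N))" by (rule row[OF S])
        finally show "(\<Sum>g\<in>S. \<bar>U g (k + a) - V g (k + b)\<bar>) \<le> 2 + 4 * ln (f (Suc N))" .
      qed
      finally have "(real N)\<^sup>2 * (\<Sum>g\<in>S. \<bar>m n (\<tau> g) - m n g\<bar>) \<le> real N * (C + 4 * ln (f (Suc N)))"
        by (simp add: C_def algebra_simps)
      then have "(\<Sum>g\<in>S. \<bar>m n (\<tau> g) - m n g\<bar>) \<le> (C + 4 * ln (f (Suc N))) / real N"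
        using mult_le_cancel_left_pos[of "real N"]
        by (simp add: N_def power2_eq_square mult.assoc pos_le_divide_eq mult.commute del: of_nat_Suc)
      then show ?thesis unfolding eq by (simp add: N_def)
    qed
    have lim: "(\<lambda>n. (C + 4 * ln (f (n + 2))) / real (Suc n)) \<longlonglongrightarrow> 0"
    proof -
      have "(\<lambda>n. ln (f (n + 2)) / real (n + 2)) \<longlonglongrightarrow> 0"
        using LIMSEQ_ignore_initial_segment[OF f, of 2] .
      moreover have "(\<lambda>n. real (n + 2) / real (Suc n)) \<longlonglongrightarrow> 1" "(\<lambda>n. C / real (Suc n)) \<longlonglongrightarrow> 0"
        by real_asymp+
      ultimately have "(\<lambda>n. C / real (Suc n) + 4 * (ln (f (n + 2)) / real (n + 2) * (real (n + 2) / real (Suc n)))) \<longlonglongrightarrow> 0 + 4 * (0 * 1)"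
        by (intro tendsto_intros)
      moreover have "C / real (Suc n) + 4 * (ln (f (n + 2)) / real (n + 2) * (real (n + 2) / real (Suc n)))
        = (C + 4 * ln (f (n + 2))) / real (Suc n)" for n
        by (simp add: add_divide_distrib del: of_nat_Suc of_nat_add)
      ultimately show ?thesis by simp
    qed
    have "(\<lambda>n. \<Sum>\<^sub>\<infinity>g\<in>X. \<bar>m n (\<tau> g) - m n g\<bar>) \<longlonglongrightarrow> 0"
      by (rule tendsto_sandwich[OF _ _ tendsto_const lim])
        (auto intro!: always_eventually infsum_nonneg bound simp del: of_nat_Suc add_2_eq_Suc')
    then show ?thesis unfolding X_def x_def \<tau>_def .
  qed
  show ?thesis
    unfolding amenable_def
    by (rule exI[of _ m]) (use m_meas m_nonneg m_sum m_inv in simp)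
qed

section \<open>Paths and charts\<close>

context self_similar_action
begin

lemma tail_in_units: "e \<in> arcs E \<Longrightarrow> tail E e \<in> units G"
  using tail_in_verts verts_eq_units by simp

lemma head_in_units: "e \<in> arcs E \<Longrightarrow> head E e \<in> units G"
  using head_in_verts verts_eq_units by simp

text \<open>The axioms prescribe only how units act. Restricting v v = v by the cocycle identity
  makes \<open>res (head E e) e\<close> idempotent with equal source and range, hence a
  unit.\<close>

lemma res_unit:
  assumes e: "e \<in> arcs E"
  shows "res (head E e) e = tail E e"
proof -
  note u = head_in_units[OF e]
  note ua = units_arr[OF u] src_unit[OF u] rng_unit[OF u]
  have "mul G (head E e) (head E e) = head E e" using mul_src ua by metis
  then have "res (head E e) e = mul G (res (head E e) e) (res (head E e) e)"
    using res_mul[OF ua(1) ua(1) e] ua act_unit[OF e] by simp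
  then have "res (head E e) e = src G (res (head E e) e)"
    using ua e by (intro idem_imp_unit) (simp_all add: res_closed src_res rng_res act_unit)
  then show ?thesis using ua e by (simp add: src_res)
qed

lemma edge_path_imp_unit: "edge_path v p \<Longrightarrow> v \<in> units G"
  by (cases p) (auto simp: verts_eq_units head_in_units)

text \<open>The next two rules unfold \<open>path_src\<close> along the list, in step with
  \<open>edge_path\<close>, and replace its defining equation by \<open>last\<close>.\<close>

lemma path_src_Nil [simp]: "path_src (v, []) = v" by simp

lemma path_src_Cons [simp]: "path_src (v, e # p) = path_src (tail E e, p)"
  by simp

declare path_src.simps [simp del]

lemma edge_path_append:
  "edge_path v (p @ q) \<longleftrightarrow> edge_path v p \<and> edge_path (path_src (v, p)) q"
  by (induction p arbitrary: v) (auto dest: edge_path_imp_unit simp: verts_eq_units)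

lemma path_src_append [simp]: "path_src (v, p @ q) = path_src (path_src (v, p), q)"
  by (induction p arbitrary: v) auto

lemma length_act_path [simp]: "length (act_path g p) = length p"
  by (induction p arbitrary: g) auto

lemma act_path_append: "act_path g (p @ q) = act_path g p @ act_path (res_path g p) q"
  by (induction p arbitrary: g) auto

lemma res_path_append: "res_path g (p @ q) = res_path (res_path g p) q"
  by (induction p arbitrary: g) auto

lemma
  assumes "g \<in> arr G" "edge_path (src G g) p"
  shows edge_path_act_path: "edge_path (rng G g) (act_path g p)"
    and res_path_closed: "res_path g p \<in> arr G"
    and src_res_path: "src G (res_path g p) = path_src (src G g, p)"
    and rng_res_path: "rng G (res_path g p) = path_src (rng G g, act_path g p)"
  using assms
proof (induction p arbitrary: g)
  case Nil
  { case 1 then show ?case using rng_in_units by (simp add: verts_eq_units) }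
next
  case (Cons e p)
  { case 1 then show ?case using Cons.IH(1)[of "res g e"]
      by (auto simp: act_closed head_act res_closed src_res rng_res) }
  { case 4 then show ?case using Cons.IH(4)[of "res g e"]
      by (auto simp: act_closed head_act res_closed src_res rng_res) }
qed (auto simp: res_closed src_res)

lemma
  assumes "h \<in> arr G" "g \<in> arr G" "src G h = rng G g" "edge_path (src G g) p"
  shows act_path_mul: "act_path (mul G h g) p = act_path h (act_path g p)"
    and res_path_mul: "res_path (mul G h g) p = mul G (res_path h (act_path g p)) (res_path g p)"
  using assms
proof (induction p arbitrary: g h)
  case (Cons e p)
  { case 1 then show ?case using Cons.IH(1)[of "res h (act g e)" "res g e"]
      by (auto simp: act_closed head_act res_closed src_res rng_res act_mul res_mul) }
  { case 2 then show ?case using Cons.IH(2)[of "res h (act g e)" "res g e"]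
      by (auto simp: act_closed head_act res_closed src_res rng_res act_mul res_mul) }
qed auto

lemma
  assumes "edge_path u p"
  shows act_path_unit: "act_path u p = p"
    and res_path_unit: "res_path u p = path_src (u, p)"
  using assms by (induction p arbitrary: u) (auto simp: act_unit res_unit)

text \<open>By the cocycle identity the product of the two restrictions is the restriction of a
  unit, hence a unit, and inverses are unique.\<close>

lemma res_path_ginv:
  assumes "g \<in> arr G" "edge_path (src G g) p"
  shows "res_path (ginv G g) (act_path g p) = ginv G (res_path g p)"
proof -
  have g: "ginv G g \<in> arr G" "src G (ginv G g) = rng G g" "rng G (ginv G g) = src G g"
    "mul G (ginv G g) g = src G g"
    using assms by (simp_all add: ginv_closed src_ginv rng_ginv ginv_mul)
  have e: "edge_path (src G (ginv G g)) (act_path g p)" using g edge_path_act_path[OF assms] by simp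
  have "mul G (res_path (ginv G g) (act_path g p)) (res_path g p) = src G (res_path g p)"
    using res_path_mul[OF g(1) assms(1) g(2) assms(2)] g(4) res_path_unit[OF assms(2)]
      src_res_path[OF assms] by simp
  then show "res_path (ginv G g) (act_path g p) = ginv G (res_path g p)"
    using res_path_closed[OF assms] res_path_closed[OF g(1) e] src_res_path[OF g(1) e]
      rng_res_path[OF assms] g by (intro ginv_unique) auto
qed

section \<open>Infinite paths, the action on them, and cylinders\<close>

lemma infinite_paths_arcs: "w \<in> infinite_paths \<Longrightarrow> w n \<in> arcs E"
  by (simp add: infinite_paths_def)

lemma infinite_paths_tail: "w \<in> infinite_paths \<Longrightarrow> tail E (w n) = head E (w (Suc n))"
  by (simp add: infinite_paths_def)

lemma infinite_paths_units: "w \<in> infinite_paths \<Longrightarrow> head E (w n) \<in> units G"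
  by (simp add: infinite_paths_arcs head_in_units)

lemma suffix_infinite_paths: "w \<in> infinite_paths \<Longrightarrow> suffix n w \<in> infinite_paths"
  by (simp add: infinite_paths_def)

lemma
  assumes "w \<in> infinite_paths" "i \<le> j"
  shows edge_path_subsequence: "edge_path (head E (w i)) (subsequence w i j)"
    and path_src_subsequence: "path_src (head E (w i), subsequence w i j) = head E (w j)"
proof -
  have "edge_path (head E (w i)) (subsequence w i j) \<and> path_src (head E (w i), subsequence w i j) = head E (w j)"
    using assms(2)
  proof (induction j rule: dec_induct)
    case base
    then show ?case using infinite_paths_units[OF assms(1)] by (simp add: verts_eq_units)
  next
    case (step n)
    then show ?case using infinite_paths_units[OF assms(1)] infinite_paths_tail[OF assms(1)]
        infinite_paths_arcs[OF assms(1)]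
      by (simp add: verts_eq_units edge_path_append)
  qed
  then show "edge_path (head E (w i)) (subsequence w i j)"
    and "path_src (head E (w i), subsequence w i j) = head E (w j)" by auto
qed

lemma conc_infinite_paths:
  assumes "edge_path v p" "w \<in> infinite_paths" "path_src (v, p) = head E (w 0)"
  shows "p \<frown> w \<in> infinite_paths \<and> head E ((p \<frown> w) 0) = v"
  using assms
proof (induction p arbitrary: v)
  case (Cons e p)
  then have IH: "p \<frown> w \<in> infinite_paths" "head E ((p \<frown> w) 0) = tail E e" by auto
  have "((e ## p \<frown> w) n) \<in> arcs E \<and> tail E ((e ## p \<frown> w) n) = head E ((e ## p \<frown> w) (Suc n))" for n
    using IH Cons.prems by (cases n) (auto simp: infinite_paths_def)
  then show ?case using Cons.prems by (auto simp: infinite_paths_def)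
qed auto

lemma subsequence_split: "i \<le> j \<Longrightarrow> j \<le> k \<Longrightarrow> subsequence w i k = subsequence w i j @ subsequence w j k"
  unfolding subsequence_def by (metis le_add_diff_inverse map_append upt_add_eq_append)

lemma prefix_act_infinite: "prefix n (act_infinite g w) = act_path g (prefix n w)"
  by (induction n) (auto simp: act_path_append act_infinite_def)

lemma suffix_act_infinite:
  "suffix n (act_infinite g w) = act_infinite (res_path g (prefix n w)) (suffix n w)"
  by (rule ext) (simp add: act_infinite_def subsequence_append res_path_append)

lemma
  assumes "g \<in> arr G" "w \<in> infinite_paths" "src G g = head E (w 0)"
  shows act_infinite_closed: "act_infinite g w \<in> infinite_paths"
    and head_act_infinite: "head E (act_infinite g w 0) = rng G g"
proof -
  have n: "res_path g (prefix n w) \<in> arr G" "src G (res_path g (prefix n w)) = head E (w n)" for n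
    using edge_path_subsequence[OF assms(2), of 0 n] path_src_subsequence[OF assms(2), of 0 n] assms
    by (simp_all add: res_path_closed src_res_path)
  have "tail E (act_infinite g w n) = head E (act_infinite g w (Suc n))" for n
    using n[of n] n[of "Suc n"] infinite_paths_arcs[OF assms(2)]
    by (simp add: act_infinite_def head_act rng_res[symmetric] res_path_append)
  then show "act_infinite g w \<in> infinite_paths"
    using n infinite_paths_arcs[OF assms(2)] by (simp add: infinite_paths_def act_infinite_def act_closed)
  show "head E (act_infinite g w 0) = rng G g"
    using assms infinite_paths_arcs[OF assms(2)] by (simp add: act_infinite_def head_act)
qed

text \<open>The letters of an infinite path are read off from its prefixes, to which the identity
  for finite paths applies; length \<open>Suc n\<close> is what makes letter \<open>n\<close>
  visible.\<close>

lemma act_infinite_mul: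
  assumes "h \<in> arr G" "g \<in> arr G" "src G h = rng G g" "w \<in> infinite_paths" "src G g = head E (w 0)"
  shows "act_infinite (mul G h g) w = act_infinite h (act_infinite g w)"
proof
  fix n
  have e: "edge_path (src G g) (prefix n w)" "edge_path (src G g) (prefix (Suc n) w)"
    using edge_path_subsequence[OF assms(4), of 0] assms(5) by (simp_all del: subseq_to_Suc)
  have "prefix (Suc n) (act_infinite (mul G h g) w) = prefix (Suc n) (act_infinite h (act_infinite g w))"
    using e by (simp only: prefix_act_infinite act_path_mul[OF assms(1-3)])
  then show "act_infinite (mul G h g) w n = act_infinite h (act_infinite g w) n" by simp
qed

lemma act_infinite_unit:
  assumes "w \<in> infinite_paths"
  shows "act_infinite (head E (w 0)) w = w"
proof
  fix n
  have "prefix (Suc n) (act_infinite (head E (w 0)) w) = prefix (Suc n) w"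
    using edge_path_subsequence[OF assms, of 0 "Suc n"] by (simp only: prefix_act_infinite act_path_unit)
  then show "act_infinite (head E (w 0)) w n = w n" by simp
qed

text \<open>For the empty list the prefix condition is void, and the cylinder of a vertex is cut out
  by \<open>head E (w 0) = v\<close> alone.\<close>

lemma cylinder_eq:
  assumes "edge_path v p"
  shows "cylinder (v, p) = {w \<in> infinite_paths. head E (w 0) = v \<and> prefix (length p) w = p}"
proof (intro set_eqI iffI)
  fix z assume "z \<in> cylinder (v, p)"
  then show "z \<in> {w \<in> infinite_paths. head E (w 0) = v \<and> prefix (length p) w = p}"
    using conc_infinite_paths[OF assms] by (auto simp: cylinder_def)
next
  fix w assume "w \<in> {w \<in> infinite_paths. head E (w 0) = v \<and> prefix (length p) w = p}"
  then have w: "w \<in> infinite_paths" "head E (w 0) = v" "prefix (length p) w = p" by auto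
  have "w = p \<frown> suffix (length p) w" using prefix_suffix[of w "length p"] w(3) by simp
  then show "w \<in> cylinder (v, p)"
    using w path_src_subsequence[OF w(1), of 0 "length p"] suffix_infinite_paths[OF w(1)]
    by (auto simp: cylinder_def intro!: exI[of _ "suffix (length p) w"])
qed

text \<open>
  A pair of a nonzero semigroup element and a point \<open>w\<close> of its domain is the same as a
  configuration \<open>chart x i f w j\<close>: the arrow \<open>f\<close> maps the \<open>j\<close>-th tail of \<open>w\<close> to the \<open>i\<close>-th
  tail of the image \<open>x\<close>. Restricting to a smaller cylinder adds the same number to \<open>i\<close> and \<open>j\<close>,
  so the charts of composable germs can be chosen to meet at a common level of the middle point.
\<close>

definition tri :: "'e word \<Rightarrow> nat \<Rightarrow> 'g \<Rightarrow> 'e word \<Rightarrow> nat \<Rightarrow> ('g, 'e) triple" where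
  "tri x i f w j = Some ((head E (x 0), prefix i x), f, (head E (w 0), prefix j w))"

definition chart :: "'e word \<Rightarrow> nat \<Rightarrow> 'g \<Rightarrow> 'e word \<Rightarrow> nat \<Rightarrow> bool" where
  "chart x i f w j \<longleftrightarrow> x \<in> infinite_paths \<and> w \<in> infinite_paths \<and> f \<in> arr G \<and>
     src G f = head E (w j) \<and> rng G f = head E (x i) \<and> act_infinite f (suffix j w) = suffix i x"

lemma germ_pairs_Some:
  "(Some ((v, p), g, (u, q)), w) \<in> germ_pairs \<longleftrightarrow>
    edge_path v p \<and> edge_path u q \<and> g \<in> arr G \<and> path_src (v, p) = rng G g \<and> path_src (u, q) = src G g \<and>
    w \<in> infinite_paths \<and> head E (w 0) = u \<and> prefix (length q) w = q"
  by (auto simp: germ_pairs_def semigroup_elems_def paths_def cylinder_eq)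

lemma apply_tri: "chart x i f w j \<Longrightarrow> apply_triple (tri x i f w j) w = x"
  using prefix_suffix[of x i] by (simp add: tri_def chart_def)

lemma tri_germ_pairs: "chart x i f w j \<Longrightarrow> (tri x i f w j, w) \<in> germ_pairs"
  unfolding tri_def germ_pairs_Some
  using edge_path_subsequence[of x 0 i] edge_path_subsequence[of w 0 j]
    path_src_subsequence[of x 0 i] path_src_subsequence[of w 0 j]
  by (simp add: chart_def)

text \<open>Here \<open>x\<close> is the image point, and \<open>i\<close>, \<open>j\<close> are the
  lengths of the two paths of the triple. This is the passage from triples to charts.\<close>

lemma germ_pairsE:
  assumes "(a, w) \<in> germ_pairs"
  obtains x i f j where "chart x i f w j" "a = tri x i f w j" "apply_triple a w = x"
proof -
  obtain v p g u q where a: "a = Some ((v, p), g, (u, q))"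
    using assms by (auto simp: germ_pairs_def semigroup_elems_def)
  note w = assms[unfolded a germ_pairs_Some]
  define y where "y = act_infinite g (suffix (length q) w)"
  have s: "suffix (length q) w \<in> infinite_paths" "src G g = head E (suffix (length q) w 0)"
    using w path_src_subsequence[of w 0 "length q"] by (auto simp: suffix_infinite_paths)
  have y: "y \<in> infinite_paths" "head E (y 0) = rng G g"
    unfolding y_def using act_infinite_closed[OF _ s] head_act_infinite[OF _ s] w by blast+
  have x: "p \<frown> y \<in> infinite_paths" "head E ((p \<frown> y) 0) = v"
    using conc_infinite_paths[of v p y] w y by auto
  show ?thesis
    by (rule that[of "p \<frown> y" "length p" g "length q"])
      (use w x y s in \<open>auto simp: chart_def tri_def a y_def\<close>)
qed

lemma act_path_chart:
  assumes "chart x i f w j" "j \<le> n"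
  shows "act_path f (subsequence w j n) = subsequence x i (i + (n - j))"
proof -
  have "act_path f (subsequence w j n) = act_path f (prefix (n - j) (suffix j w))"
    by (simp only: subsequence_prefix_suffix)
  also have "\<dots> = prefix (n - j) (suffix i x)"
    unfolding prefix_act_infinite[symmetric] using assms by (simp add: chart_def)
  finally show ?thesis by simp
qed

lemma edge_path_chart:
  assumes "chart x i f w j" "j \<le> n"
  shows "edge_path (src G f) (subsequence w j n)"
  using assms edge_path_subsequence[of w j n] by (simp add: chart_def)

text \<open>Restricting (p, g, q) to the cylinder of q t gives (p g(t), g|t, q t). Both levels grow
  by the same amount, so the degree i - j is kept.\<close>

lemma chart_bump:
  assumes "chart x i f w j" "j \<le> n"
  shows "chart x (i + (n - j)) (res_path f (subsequence w j n)) w n"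
proof -
  have f: "f \<in> arr G" "w \<in> infinite_paths" "x \<in> infinite_paths" "src G f = head E (w j)"
    "act_infinite f (suffix j w) = suffix i x" "rng G f = head E (x i)"
    using assms by (auto simp: chart_def)
  note e = edge_path_chart[OF assms]
  have "act_infinite (res_path f (subsequence w j n)) (suffix n w) = suffix (i + (n - j)) x"
    using suffix_act_infinite[of "n - j" f "suffix j w"] assms(2) f(5) by simp
  then show ?thesis
    using res_path_closed[OF f(1) e] src_res_path[OF f(1) e] rng_res_path[OF f(1) e] f assms(2)
      path_src_subsequence[of w j n] path_src_subsequence[of x i "i + (n - j)"] act_path_chart[OF assms]
    by (simp add: chart_def)
qed

lemma chart_mul:
  assumes "chart x i f y j" "chart y j g w k"
  shows "chart x i (mul G f g) w k"
  using assms act_infinite_mul[of f g "suffix k w"] suffix_infinite_paths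
  by (simp add: chart_def mul_closed src_mul rng_mul)

lemma chart_ginv:
  assumes "chart x i f w j"
  shows "chart w j (ginv G f) x i"
proof -
  have "act_infinite (ginv G f) (act_infinite f (suffix j w)) = act_infinite (head E (suffix j w 0)) (suffix j w)"
    using assms act_infinite_mul[of "ginv G f" f "suffix j w"] suffix_infinite_paths
    by (simp add: chart_def ginv_closed src_ginv rng_ginv ginv_mul)
  then show ?thesis
    using assms act_infinite_unit[OF suffix_infinite_paths]
    by (simp add: chart_def ginv_closed src_ginv rng_ginv)
qed

lemma chart_unit: "w \<in> infinite_paths \<Longrightarrow> chart w n (head E (w n)) w n"
  using act_infinite_unit[OF suffix_infinite_paths, of w n] infinite_paths_units[of w n]
  by (simp add: chart_def units_arr src_unit rng_unit)

text \<open>Both inner paths are prefixes of the same point \<open>y\<close>, so one extends the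
  other and the product is never zero. Their lengths decide which branch of the definition
  applies.\<close>

lemma mult_tri:
  assumes f: "chart x i f y j" and g: "chart y j' g w k"
  shows "semigroup_mult (tri x i f y j) (tri y j' g w k) =
    (if j \<le> j' then tri x (i + (j' - j)) (mul G (res_path f (subsequence y j (j'))) g) w k
     else tri x i (mul G f (res_path g (subsequence w k (k + (j - j'))))) w (k + (j - j')))"
proof (cases "j \<le> j'")
  case True
  then have "extends (head E (y 0), prefix j' y) (head E (y 0), prefix j y)"
    using subsequence_split[of 0 j j' y] by auto
  then show ?thesis
    using True act_path_chart[OF f True] subsequence_split[of 0 i "i + (j' - j)" x]
    by (simp add: tri_def Let_def)
next
  case False
  then have ext: "extends (head E (y 0), prefix j y) (head E (y 0), prefix j' y)"
    using subsequence_split[of 0 j' j y] by auto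
  have "\<not> extends (head E (y 0), prefix j' y) (head E (y 0), prefix j y)"
  proof
    assume "extends (head E (y 0), prefix j' y) (head E (y 0), prefix j y)"
    then obtain t where "prefix j' y = prefix j y @ t" by auto
    then have "length (prefix j' y) = length (prefix j y @ t)" by (rule arg_cong)
    with False show False by simp
  qed
  moreover have "act_path (ginv G g) (subsequence y (j') j) = subsequence w k (k + (j - j'))"
    using act_path_chart[OF chart_ginv[OF g], of j] False by simp
  ultimately show ?thesis
    using False ext subsequence_split[of 0 k "k + (j - j')" w]
    by (simp add: tri_def Let_def)
qed

lemma chart_mult_tri:
  assumes "chart x i f y j" "chart y j' g w k"
  obtains i' h k' where "chart x i' h w k'" "semigroup_mult (tri x i f y j) (tri y j' g w k) = tri x i' h w k'"
proof (cases "j \<le> j'")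
  case True
  then show ?thesis
    using that[OF chart_mul[OF chart_bump[OF assms(1) True] assms(2)]] mult_tri[OF assms] by simp
next
  case False
  then have "chart y j (res_path g (subsequence w k (k + (j - j')))) w (k + (j - j'))"
    using chart_bump[OF assms(2), of "k + (j - j')"] by simp
  from chart_mul[OF assms(1) this] show ?thesis
    using that mult_tri[OF assms] False by simp
qed

end

section \<open>The groupoid of germs\<close>

lemma prefix_eq_iff: "prefix n z = prefix n w \<longleftrightarrow> (\<forall>i<n. z i = w i)"
  by (auto simp: list_eq_iff_nth_eq)

context self_similar_action
begin

lemma germ_pair_cases:
  assumes "p \<in> germ_pairs"
  obtains x i f w j where "chart x i f w j" "p = (tri x i f w j, w)"
proof -
  obtain a w where p: "p = (a, w)" by (cases p)
  show ?thesis
  proof (rule germ_pairsE[OF assms[unfolded p]])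
    fix x i f j assume "chart x i f w j" "a = tri x i f w j"
    then show ?thesis using that p by blast
  qed
qed

lemma idem_tri:
  assumes w: "w \<in> infinite_paths"
  shows "tri w n (head E (w n)) w n \<in> idempotents" "w \<in> dom_of (tri w n (head E (w n)) w n)"
proof -
  note c = chart_unit[OF w, of n]
  have "mul G (head E (w n)) (head E (w n)) = head E (w n)"
    using mul_src[of "head E (w n)"] infinite_paths_units[OF w, of n] by (simp add: units_arr src_unit)
  then show "tri w n (head E (w n)) w n \<in> idempotents" "w \<in> dom_of (tri w n (head E (w n)) w n)"
    using tri_germ_pairs[OF c] mult_tri[OF c c] by (auto simp: idempotents_def germ_pairs_def)
qed

text \<open>A nonempty overlap \<open>t\<close> would lengthen one of the two paths in the square,
  so the paths agree. The square then has middle arrow g g, so \<open>g\<close> is idempotent and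
  hence a unit.\<close>

lemma idem_cases:
  assumes e: "e \<in> idempotents" and w: "w \<in> dom_of e"
  obtains n where "w \<in> infinite_paths" "e = tri w n (head E (w n)) w n"
proof -
  have pair: "(e, w) \<in> germ_pairs" using e w by (auto simp: germ_pairs_def idempotents_def)
  obtain v p g u q where E: "e = Some ((v, p), g, (u, q))"
    using pair by (auto simp: germ_pairs_def semigroup_elems_def)
  note P = pair[unfolded E germ_pairs_Some]
  have mult: "semigroup_mult e e = e" using e by (simp add: idempotents_def)
  have "(v, p) = (u, q) \<and> mul G g g = g"
  proof (cases "extends (v, p) (u, q)")
    case True
    then obtain t where t: "v = u" "p = q @ t" by auto
    have "length (act_path g t) = 0" using mult True t by (simp add: E Let_def)
    then have "t = []" by simp
    then show ?thesis using mult t by (simp add: E)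
  next
    case False
    show ?thesis
    proof (cases "extends (u, q) (v, p)")
      case True
      then obtain t where t: "v = u" "q = p @ t" by auto
      have "length (act_path (ginv G g) t) = 0" using mult True False t by (simp add: E Let_def)
      then have "t = []" by simp
      then show ?thesis using False t by simp
    next
      case F2: False
      have "semigroup_mult e e = None"
        unfolding E semigroup_mult.simps if_not_P[OF False] if_not_P[OF F2] ..
      then show ?thesis using mult E by simp
    qed
  qed
  then have eq: "v = u" "p = q" "mul G g g = g" by auto
  have "g = src G g" using P eq by (intro idem_imp_unit) auto
  then have "g = head E (w (length q))" using P path_src_subsequence[of w 0 "length q"] by auto
  then show ?thesis using that[of "length q"] P eq by (simp add: E tri_def)
qed

text \<open>If n < j, then n - j is 0 and the segment from \<open>j\<close> to \<open>n\<close> is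
  empty, so the same formula says that the idempotent leaves the chart alone.\<close>

lemma mult_tri_idem:
  assumes c: "chart x i f w j"
  shows "semigroup_mult (tri x i f w j) (tri w n (head E (w n)) w n)
    = tri x (i + (n - j)) (res_path f (subsequence w j n)) w (max j n)"
proof (cases "j \<le> n")
  case True
  have "chart x (i + (n - j)) (res_path f (subsequence w j n)) w n" by (rule chart_bump[OF c True])
  then have "mul G (res_path f (subsequence w j n)) (head E (w n)) = res_path f (subsequence w j n)"
    using mul_src[of "res_path f (subsequence w j n)"] by (simp add: chart_def)
  then show ?thesis using True mult_tri[OF c chart_unit, of n] c by (simp add: chart_def max_def)
next
  case False
  have w: "w \<in> infinite_paths" using c by (simp add: chart_def)
  have "res_path (head E (w n)) (subsequence w n j) = head E (w j)"
    using edge_path_subsequence[OF w, of n j] path_src_subsequence[OF w, of n j] False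
    by (simp add: res_path_unit)
  then have "mul G f (res_path (head E (w n)) (subsequence w n j)) = f"
    using c mul_src[of f] by (simp add: chart_def)
  then show ?thesis using False mult_tri[OF c chart_unit, of n] w by (simp add: max_def)
qed

lemma res_path_chart_append:
  "j \<le> n \<Longrightarrow> n \<le> n' \<Longrightarrow>
    res_path f (subsequence w j n') = res_path (res_path f (subsequence w j n)) (subsequence w n n')"
  using subsequence_split[of j n n' w] by (simp add: res_path_append)

text \<open>Multiplying by an idempotent defined at \<open>w\<close> only moves a chart to a level
  at least as deep. So germs agree exactly if their charts coincide at some level: equal points,
  equal degree i - j (written without subtraction), and equal restrictions, which then stay equal at
  all deeper levels.\<close>

lemma germ_rel_tri:
  assumes c: "chart x i f w j" and c': "chart x' i' f' w' j'"
  shows "((tri x i f w j, w), (tri x' i' f' w' j', w')) \<in> germ_rel \<longleftrightarrow>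
    w = w' \<and> x = x' \<and> i + j' = i' + j \<and>
    (\<exists>N. \<forall>n\<ge>N. res_path f (subsequence w j n) = res_path f' (subsequence w' j' n))"
    (is "?L \<longleftrightarrow> ?R")
proof
  assume ?L
  then obtain e where ww: "w = w'" and e: "e \<in> idempotents" "w \<in> dom_of e"
    and eq: "semigroup_mult (tri x i f w j) e = semigroup_mult (tri x' i' f' w' j') e"
    by (auto simp: germ_rel_def)
  note c' = c'[folded ww]
  obtain n where en: "e = tri w n (head E (w n)) w n" using idem_cases[OF e] by metis
  define n0 where "n0 = max j n"
  have t: "tri x (i + (n - j)) (res_path f (subsequence w j n)) w (max j n) =
     tri x' (i' + (n - j')) (res_path f' (subsequence w j' n)) w (max j' n)"
    using eq mult_tri_idem[OF c, of n] mult_tri_idem[OF c', of n] by (simp add: en ww)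
  \<comment> \<open>Comparing the lengths of the right paths shows that the idempotent brings both
    charts to the same level, which replaces \<open>n\<close> from here on.\<close>
  have "max j n = max j' n" using t[unfolded tri_def] by (auto dest!: arg_cong[where f=length])
  then have n0: "j \<le> n0" "j' \<le> n0" "n0 = max j' n" "subsequence w j n = subsequence w j n0"
    "subsequence w j' n = subsequence w j' n0" "n - j = n0 - j" "n - j' = n0 - j'"
    by (auto simp: n0_def max_def split: if_splits)
  have t0: "prefix (i + (n0 - j)) x = prefix (i' + (n0 - j')) x'"
     "res_path f (subsequence w j n0) = res_path f' (subsequence w j' n0)"
    using t[unfolded tri_def n0(4-7)] by auto
  have i: "i + (n0 - j) = i' + (n0 - j')" using t0(1) by (auto dest!: arg_cong[where f=length])
  have "suffix (i + (n0 - j)) x = suffix (i' + (n0 - j')) x'"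
    using chart_bump[OF c n0(1)] chart_bump[OF c' n0(2)] t0(2) by (simp add: chart_def)
  then have x: "x = x'" using t0(1) by (metis prefix_suffix)
  have "\<forall>n\<ge>n0. res_path f (subsequence w j n) = res_path f' (subsequence w j' n)"
    using t0(2) res_path_chart_append[OF n0(1)] res_path_chart_append[OF n0(2)] by metis
  moreover have "i + j' = i' + j" using i n0(1,2) by linarith
  ultimately show ?R using x ww by blast
next
  assume R: ?R
  then obtain N where N: "\<And>n. n \<ge> N \<Longrightarrow> res_path f (subsequence w j n) = res_path f' (subsequence w j' n)"
    by auto
  define n where "n = j + j' + N"
  have n: "n \<ge> j" "n \<ge> j'" "n \<ge> N" by (auto simp: n_def)
  have w: "w \<in> infinite_paths" "w = w'" using c R by (auto simp: chart_def)
  have "i + (n - j) = i' + (n - j')" using n R by auto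
  then have "semigroup_mult (tri x i f w j) (tri w n (head E (w n)) w n)
     = semigroup_mult (tri x' i' f' w' j') (tri w n (head E (w n)) w n)"
    using mult_tri_idem[OF c, of n] mult_tri_idem[OF c', of n] N[OF n(3)] conjunct1[OF conjunct2[OF R]]
      n w(2) by (simp add: max_absorb2)
  then show ?L using idem_tri[OF w(1), of n] tri_germ_pairs[OF c] tri_germ_pairs[OF c'] w(2)
    by (auto simp: germ_rel_def)
qed

lemma equiv_germ_rel: "equiv germ_pairs germ_rel"
proof (rule equivI)
  show "germ_rel \<subseteq> germ_pairs \<times> germ_pairs" by (auto simp: germ_rel_def)
  show "refl_on germ_pairs germ_rel"
  proof (rule refl_onI)
    fix p assume "p \<in> germ_pairs"
    then obtain x i f w j where c: "chart x i f w j" and p: "p = (tri x i f w j, w)"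
      by (rule germ_pair_cases)
    show "(p, p) \<in> germ_rel" unfolding p germ_rel_tri[OF c c] by blast
  qed
  show "sym germ_rel" by (auto simp: sym_def germ_rel_def)
  show "trans germ_rel"
  proof (rule transI)
    fix p q r assume pq: "(p, q) \<in> germ_rel" and qr: "(q, r) \<in> germ_rel"
    have pair: "p \<in> germ_pairs" "q \<in> germ_pairs" "r \<in> germ_pairs"
      using pq qr by (auto simp: germ_rel_def)
    obtain x i f w j where cp: "chart x i f w j" and p: "p = (tri x i f w j, w)"
      using pair(1) by (rule germ_pair_cases)
    obtain x' i' f' w' j' where cq: "chart x' i' f' w' j'" and q: "q = (tri x' i' f' w' j', w')"
      using pair(2) by (rule germ_pair_cases)
    obtain x2 i2 f2 w2 j2 where cr: "chart x2 i2 f2 w2 j2" and r: "r = (tri x2 i2 f2 w2 j2, w2)"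
      using pair(3) by (rule germ_pair_cases)
    obtain N where N: "\<And>n. n \<ge> N \<Longrightarrow> res_path f (subsequence w j n) = res_path f' (subsequence w' j' n)"
      and eq: "w = w'" "x = x'" "i + j' = i' + j"
      using pq unfolding p q germ_rel_tri[OF cp cq] by blast
    obtain N' where N': "\<And>n. n \<ge> N' \<Longrightarrow> res_path f' (subsequence w' j' n) = res_path f2 (subsequence w2 j2 n)"
      and eq': "w' = w2" "x' = x2" "i' + j2 = i2 + j'"
      using qr unfolding q r germ_rel_tri[OF cq cr] by blast
    have "\<forall>n\<ge>max N N'. res_path f (subsequence w j n) = res_path f2 (subsequence w2 j2 n)"
      using N N' by simp
    moreover have "i + j2 = i2 + j" using eq eq' by linarith
    ultimately show "(p, r) \<in> germ_rel"
      using eq eq' unfolding p r germ_rel_tri[OF cp cr] by blast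
  qed
qed

section \<open>Germs in standard form and well-definedness of the operations\<close>

definition std :: "'e word \<Rightarrow> nat \<Rightarrow> 'g \<Rightarrow> 'e word \<Rightarrow> nat \<Rightarrow> ('g, 'e) germ" where
  "std x i f w j = germ (tri x i f w j) w"

lemma germ_eq_iff:
  assumes "(a, w) \<in> germ_pairs" "(b, z) \<in> germ_pairs"
  shows "germ a w = germ b z \<longleftrightarrow> ((a, w), (b, z)) \<in> germ_rel"
  unfolding germ_def using eq_equiv_class_iff[OF equiv_germ_rel assms] .

lemma std_eq_iff:
  assumes c: "chart x i f w j" and c': "chart x' i' f' w' j'"
  shows "std x i f w j = std x' i' f' w' j' \<longleftrightarrow>
    w = w' \<and> x = x' \<and> i + j' = i' + j \<and>
    (\<exists>N. \<forall>n\<ge>N. res_path f (subsequence w j n) = res_path f' (subsequence w' j' n))"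
  unfolding std_def germ_eq_iff[OF tri_germ_pairs[OF c] tri_germ_pairs[OF c']]
  by (rule germ_rel_tri[OF c c'])

text \<open>This provides representatives of a germ at all levels from \<open>j\<close> on, so that
  several germs can be brought to a common level.\<close>

lemma std_bump:
  assumes c: "chart x i f w j" and n: "j \<le> n"
  shows "std x i f w j = std x (i + (n - j)) (res_path f (subsequence w j n)) w n"
  unfolding std_eq_iff[OF c chart_bump[OF c n]]
proof (intro conjI exI[of _ n] allI impI)
  show "i + n = i + (n - j) + j" using n by simp
qed (use res_path_chart_append[OF n] in blast)+

lemma std_unit:
  assumes w: "w \<in> infinite_paths"
  shows "germ_unit w = std w n (head E (w n)) w n"
proof -
  have "germ_unit w = std w 0 (head E (w 0)) w 0"
    by (simp add: germ_unit_def std_def tri_def Let_def)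
  also have "\<dots> = std w n (head E (w n)) w n"
    using std_bump[OF chart_unit[OF w, of 0], of n] edge_path_subsequence[OF w, of 0 n]
      path_src_subsequence[OF w, of 0 n] by (simp add: res_path_unit)
  finally show ?thesis .
qed

lemma germ_unit_inject:
  assumes "w \<in> infinite_paths" "z \<in> infinite_paths"
  shows "germ_unit w = germ_unit z \<longleftrightarrow> w = z"
  unfolding std_unit[OF assms(1), of 0] std_unit[OF assms(2), of 0]
    std_eq_iff[OF chart_unit[OF assms(1)] chart_unit[OF assms(2)]] by auto

lemma germ_arrE:
  assumes "X \<in> arr germ_groupoid"
  obtains x i f w j where "chart x i f w j" "X = std x i f w j"
proof -
  obtain a w where aw: "(a, w) \<in> germ_pairs" "X = germ a w"
    using assms by (auto simp: germ_groupoid_def quotient_def germ_def)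
  from germ_pairsE[OF aw(1)] show ?thesis using that aw(2) unfolding std_def by metis
qed

lemma germ_arr: "(a, w) \<in> germ_pairs \<Longrightarrow> germ a w \<in> arr germ_groupoid"
  by (simp add: germ_groupoid_def germ_def quotientI)

lemma std_arr: "chart x i f w j \<Longrightarrow> std x i f w j \<in> arr germ_groupoid"
  unfolding std_def by (rule germ_arr) (rule tri_germ_pairs)

text \<open>All members of a germ share the source point, the image point and the germ. This makes
  the unions defining source and range constant, and it is the starting point for product and
  inverse.\<close>

lemma std_members:
  assumes c: "chart x i f w j"
  shows "(tri x i f w j, w) \<in> std x i f w j"
    and "(b, z) \<in> std x i f w j \<Longrightarrow> z = w \<and> apply_triple b z = x \<and> (b, z) \<in> germ_pairs \<and> germ b z = std x i f w j"
proof -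
  show "(tri x i f w j, w) \<in> std x i f w j"
    unfolding std_def germ_def using tri_germ_pairs[OF c] equiv_germ_rel
    by (simp add: equiv_def refl_on_def)
  assume b: "(b, z) \<in> std x i f w j"
  then have rel: "((tri x i f w j, w), (b, z)) \<in> germ_rel" by (simp add: std_def germ_def)
  then have bz: "(b, z) \<in> germ_pairs" by (auto simp: germ_rel_def)
  then obtain x' i' f' j' where c': "chart x' i' f' z j'" and b: "b = tri x' i' f' z j'" "apply_triple b z = x'"
    by (elim germ_pairsE)
  have "germ (tri x i f w j) w = germ b z" using rel germ_eq_iff[OF tri_germ_pairs[OF c] bz] by simp
  moreover have "z = w" "x' = x" using rel germ_rel_tri[OF c c'] b by auto
  ultimately show "z = w \<and> apply_triple b z = x \<and> (b, z) \<in> germ_pairs \<and> germ b z = std x i f w j"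
    using b bz by (simp add: std_def)
qed

lemma UN_constant_on: "(\<And>p. p \<in> X \<Longrightarrow> F p = c) \<Longrightarrow> X \<noteq> {} \<Longrightarrow> (\<Union>p\<in>X. F p) = c"
  by auto

lemma
  assumes c: "chart x i f w j"
  shows src_std: "src germ_groupoid (std x i f w j) = germ_unit w"
    and rng_std: "rng germ_groupoid (std x i f w j) = germ_unit x"
proof -
  have "(case p of (a, z) \<Rightarrow> germ_unit z) = germ_unit w"
    "(case p of (a, z) \<Rightarrow> germ_unit (apply_triple a z)) = germ_unit x"
    if "p \<in> std x i f w j" for p
    using std_members(2)[OF c, of "fst p" "snd p"] that by (cases p; force)+
  then have "(\<Union>(a, z)\<in>std x i f w j. germ_unit z) = germ_unit w"
    "(\<Union>(a, z)\<in>std x i f w j. germ_unit (apply_triple a z)) = germ_unit x"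
    using std_members(1)[OF c] by (auto intro!: UN_constant_on)
  then show "src germ_groupoid (std x i f w j) = germ_unit w"
    "rng germ_groupoid (std x i f w j) = germ_unit x"
    by (simp_all add: germ_groupoid_def)
qed

text \<open>At a level \<open>n\<close> of the middle point beyond both \<open>j\<close> and
  \<open>j'\<close> the case distinction of the product disappears. The factors enter only through
  their restrictions there, which makes the product independent of representatives.\<close>

lemma mult_std:
  assumes f: "chart x i f y j" and g: "chart y j' g w k" and n: "j \<le> n" "j' \<le> n"
  shows "germ (semigroup_mult (tri x i f y j) (tri y j' g w k)) w
    = std x (i + (n - j)) (mul G (res_path f (subsequence y j n)) (res_path g (subsequence w k (k + (n - j')))))
        w (k + (n - j'))"
proof (cases "j \<le> j'")
  case True
  define f' where "f' = res_path f (subsequence y j j')"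
  have f': "chart x (i + (j' - j)) f' y j'" unfolding f'_def by (rule chart_bump[OF f True])
  have "germ (semigroup_mult (tri x i f y j) (tri y j' g w k)) w = std x (i + (j' - j)) (mul G f' g) w k"
    using mult_tri[OF f g] True by (simp add: std_def f'_def)
  also have "\<dots> = std x (i + (j' - j) + (n - j')) (res_path (mul G f' g) (subsequence w k (k + (n - j')))) w (k + (n - j'))"
    using std_bump[OF chart_mul[OF f' g], of "k + (n - j')"] by simp
  also have "res_path (mul G f' g) (subsequence w k (k + (n - j')))
    = mul G (res_path f' (subsequence y j' n)) (res_path g (subsequence w k (k + (n - j'))))"
    using f' g edge_path_chart[OF g, of "k + (n - j')"] act_path_chart[OF g, of "k + (n - j')"] n
    by (subst res_path_mul) (auto simp: chart_def)
  also have "res_path f' (subsequence y j' n) = res_path f (subsequence y j n)"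
    unfolding f'_def using res_path_chart_append[OF True n(2)] by simp
  finally show ?thesis using True n by simp
next
  case False
  define d where "d = j - j'"
  have d: "j' + d = j" "k + d \<le> k + (n - j')" "k \<le> k + d" using False n by (auto simp: d_def)
  define g' where "g' = res_path g (subsequence w k (k + d))"
  have g': "chart y j g' w (k + d)" unfolding g'_def using chart_bump[OF g d(3)] d(1) by simp
  have "germ (semigroup_mult (tri x i f y j) (tri y j' g w k)) w = std x i (mul G f g') w (k + d)"
    using mult_tri[OF f g] False by (simp add: std_def g'_def d_def)
  also have "\<dots> = std x (i + (n - j)) (res_path (mul G f g') (subsequence w (k + d) (k + (n - j')))) w (k + (n - j'))"
    using std_bump[OF chart_mul[OF f g'] d(2)] d n by (simp add: d_def)
  also have "res_path (mul G f g') (subsequence w (k + d) (k + (n - j')))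
    = mul G (res_path f (subsequence y j n)) (res_path g' (subsequence w (k + d) (k + (n - j'))))"
    using f g' edge_path_chart[OF g' d(2)] act_path_chart[OF g' d(2)] n d(1) False
    by (subst res_path_mul) (auto simp: chart_def)
  also have "res_path g' (subsequence w (k + d) (k + (n - j'))) = res_path g (subsequence w k (k + (n - j')))"
    unfolding g'_def using res_path_chart_append[OF d(3,2)] by simp
  finally show ?thesis .
qed

lemma mult_cong:
  assumes c1: "chart x i f y j" "chart y j' g w k"
    and c2: "chart x i2 f2 y j2" "chart y j2' g2 w k2"
    and eq: "std x i f y j = std x i2 f2 y j2" "std y j' g w k = std y j2' g2 w k2"
  shows "germ (semigroup_mult (tri x i f y j) (tri y j' g w k)) w
    = germ (semigroup_mult (tri x i2 f2 y j2) (tri y j2' g2 w k2)) w"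
proof -
  obtain N where N: "\<And>n. n \<ge> N \<Longrightarrow> res_path f (subsequence y j n) = res_path f2 (subsequence y j2 n)"
    and i: "i + j2 = i2 + j" using eq(1) std_eq_iff[OF c1(1) c2(1)] by blast
  obtain N' where N': "\<And>n. n \<ge> N' \<Longrightarrow> res_path g (subsequence w k n) = res_path g2 (subsequence w k2 n)"
    and j: "j' + k2 = j2' + k" using eq(2) std_eq_iff[OF c1(2) c2(2)] by blast
  \<comment> \<open>Large enough to pass \<open>N\<close> and all four levels at \<open>y\<close>,
    and to make the matching level k + (n - j') at \<open>w\<close> at least
    \<open>N'\<close>.\<close>
  define n where "n = N + N' + j + j' + j2 + j2'"
  have n: "N \<le> n" "j \<le> n" "j' \<le> n" "j2 \<le> n" "j2' \<le> n" "k + (n - j') \<ge> N'" by (auto simp: n_def)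
  have kk: "k + (n - j') = k2 + (n - j2')" "i + (n - j) = i2 + (n - j2)" using i j n by auto
  show ?thesis
    unfolding mult_std[OF c1 n(2,3)] mult_std[OF c2 n(4,5)]
    using N[OF n(1)] N'[OF n(6)] kk by simp
qed

text \<open>By \<open>mult_cong\<close> all products of representatives have the same germ, so the
  union in the definition runs over a singleton.\<close>

lemma mul_germ_tri:
  assumes f: "chart x i f y j" and g: "chart y j' g w k"
  shows "mul germ_groupoid (std x i f y j) (std y j' g w k)
    = germ (semigroup_mult (tri x i f y j) (tri y j' g w k)) w"
proof -
  have "{germ (semigroup_mult a b) z | a b z.
      (a, apply_triple b z) \<in> std x i f y j \<and> (b, z) \<in> std y j' g w k}
    = {germ (semigroup_mult (tri x i f y j) (tri y j' g w k)) w}" (is "?L = ?R")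
  proof (intro equalityI subsetI)
    fix X assume "X \<in> ?L"
    then obtain a b z where X: "X = germ (semigroup_mult a b) z"
      and a: "(a, apply_triple b z) \<in> std x i f y j" and b: "(b, z) \<in> std y j' g w k" by blast
    have B: "z = w" "apply_triple b z = y" "(b, w) \<in> germ_pairs" "germ b w = std y j' g w k"
      using std_members(2)[OF g b] by auto
    have A: "apply_triple a y = x" "(a, y) \<in> germ_pairs" "germ a y = std x i f y j"
      using std_members(2)[OF f a] B by auto
    obtain i2 f2 j2 where a2: "chart x i2 f2 y j2" "a = tri x i2 f2 y j2"
      using germ_pairsE[OF A(2)] A(1) by metis
    obtain j2' g2 k2 where b2: "chart y j2' g2 w k2" "b = tri y j2' g2 w k2"
      using germ_pairsE[OF B(3)] B(1,2) by metis
    show "X \<in> ?R"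
      using mult_cong[OF f g a2(1) b2(1)] A(3) B(1,4) by (simp add: X a2(2) b2(2) std_def)
  next
    fix X assume "X \<in> ?R"
    then show "X \<in> ?L"
      using std_members(1)[OF f] std_members(1)[OF g] apply_tri[OF g]
      by (intro CollectI exI[of _ "tri x i f y j"] exI[of _ "tri y j' g w k"] exI[of _ w]) auto
  qed
  then show ?thesis by (simp add: germ_groupoid_def)
qed

lemma mul_germ:
  assumes "(a, apply_triple b w) \<in> germ_pairs" "(b, w) \<in> germ_pairs"
  shows "mul germ_groupoid (germ a (apply_triple b w)) (germ b w) = germ (semigroup_mult a b) w"
    and "(semigroup_mult a b, w) \<in> germ_pairs"
proof -
  obtain y j' g k where b: "chart y j' g w k" "b = tri y j' g w k" "apply_triple b w = y"
    using germ_pairsE[OF assms(2)] by metis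
  obtain x i f j where a: "chart x i f y j" "a = tri x i f y j"
    using germ_pairsE[OF assms(1)] b(3) by metis
  show "mul germ_groupoid (germ a (apply_triple b w)) (germ b w) = germ (semigroup_mult a b) w"
    using mul_germ_tri[OF a(1) b(1)] b(3) by (simp add: std_def a(2) b(2))
  show "(semigroup_mult a b, w) \<in> germ_pairs"
    using chart_mult_tri[OF a(1) b(1)] tri_germ_pairs unfolding a(2) b(2) by metis
qed

lemma mul_std:
  assumes f: "chart x i f y j" and g: "chart y j g w k"
  shows "mul germ_groupoid (std x i f y j) (std y j g w k) = std x i (mul G f g) w k"
  using mul_germ_tri[OF assms] mult_tri[OF assms] by (simp add: std_def)

lemma ginv_std:
  assumes c: "chart x i f w j"
  shows "ginv germ_groupoid (std x i f w j) = std w j (ginv G f) x i"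
proof -
  have inv: "semigroup_inv (tri x i f w j) = tri w j (ginv G f) x i" for x i f w j
    by (simp add: tri_def)
  have "germ (semigroup_inv b) (apply_triple b z) = std w j (ginv G f) x i"
    if bz: "(b, z) \<in> std x i f w j" for b z
  proof -
    have B: "z = w" "apply_triple b z = x" "(b, w) \<in> germ_pairs" "germ b w = std x i f w j"
      using std_members(2)[OF c bz] by auto
    obtain i2 g j2 where b: "chart x i2 g w j2" "b = tri x i2 g w j2"
      using germ_pairsE[OF B(3)] B(1,2) by metis
    obtain N where i: "i2 + j = i + j2"
      and N: "\<And>n. n \<ge> N \<Longrightarrow> res_path g (subsequence w j2 n) = res_path f (subsequence w j n)"
      using B(4) std_eq_iff[OF b(1) c] by (auto simp: b(2) std_def)
    have "std w j2 (ginv G g) x i2 = std w j (ginv G f) x i"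
      unfolding std_eq_iff[OF chart_ginv[OF b(1)] chart_ginv[OF c]]
    \<comment> \<open>Level \<open>n\<close> at \<open>x\<close> corresponds at \<open>w\<close> to
      j + (n - i) for one chart and to j2 + (n - i2) for the other. These agree because the degrees
      do, and the bound on \<open>n\<close> makes them at least \<open>N\<close>.\<close>
    proof (intro conjI exI[of _ "N + i + i2"] allI impI)
      fix n assume n: "N + i + i2 \<le> n"
      have m: "j2 \<le> j2 + (n - i2)" "j \<le> j + (n - i)" "j + (n - i) = j2 + (n - i2)" "N \<le> j + (n - i)"
        "i2 + (j2 + (n - i2) - j2) = n" "i + (j + (n - i) - j) = n"
        using n i by auto
      have "res_path (ginv G g) (subsequence x i2 n) = ginv G (res_path g (subsequence w j2 (j2 + (n - i2))))"
        using res_path_ginv[OF _ edge_path_chart[OF b(1) m(1)]] act_path_chart[OF b(1) m(1)] b(1) m(5)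
        by (simp add: chart_def)
      also have "\<dots> = ginv G (res_path f (subsequence w j (j + (n - i))))"
        using N[OF m(4)] m(3) by simp
      also have "\<dots> = res_path (ginv G f) (subsequence x i n)"
        using res_path_ginv[OF _ edge_path_chart[OF c m(2)]] act_path_chart[OF c m(2)] c m(6)
        by (simp add: chart_def)
      finally show "res_path (ginv G g) (subsequence x i2 n) = res_path (ginv G f) (subsequence x i n)" .
    qed (use i in auto)
    then show ?thesis by (simp add: b(2) B inv std_def) (metis B(1,2) b(2))
  qed
  then show ?thesis
    unfolding germ_groupoid_def groupoid.simps top_groupoid.simps
    by (intro UN_constant_on) (use std_members(1)[OF c] in \<open>auto split: prod.split\<close>)
qed

text \<open>The parameter \<open>N\<close> asks for levels as deep as desired; associativity needs
  this in order to meet a third germ.\<close>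

lemma germ_compE:
  assumes X: "X \<in> arr germ_groupoid" and Y: "Y \<in> arr germ_groupoid"
    and XY: "src germ_groupoid X = rng germ_groupoid Y"
  obtains x i f y j g w k where "chart x i f y j" "chart y j g w k"
    "X = std x i f y j" "Y = std y j g w k" "N \<le> j" "N \<le> k"
proof -
  obtain x i f y j where f: "chart x i f y j" "X = std x i f y j" using germ_arrE[OF X] .
  obtain y' j' g w k where g: "chart y' j' g w k" "Y = std y' j' g w k" using germ_arrE[OF Y] .
  have y: "y' = y"
    using XY f g germ_unit_inject[of y y'] by (simp add: src_std rng_std chart_def)
  define n where "n = j + j' + N"
  have n: "j \<le> n" "k \<le> k + (n - j')" "j' + (k + (n - j') - k) = n" "N \<le> n" "N \<le> k + (n - j')"
    by (auto simp: n_def)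
  show ?thesis
    by (rule that[OF chart_bump[OF f(1) n(1)] chart_bump[OF g(1) n(2), unfolded n(3) y]])
      (use std_bump[OF f(1) n(1)] std_bump[OF g(1) n(2)] f g n y in auto)
qed

lemma groupoid_germ_groupoid: "groupoid germ_groupoid"
proof
  note W = infinite_paths_units
  { fix X assume X: "X \<in> arr germ_groupoid"
    obtain x i f w j where c: "chart x i f w j" "X = std x i f w j" using germ_arrE[OF X] .
    have w: "w \<in> infinite_paths" "x \<in> infinite_paths" using c by (auto simp: chart_def)
    note u = chart_unit[OF w(1), of j] chart_unit[OF w(2), of i]
    note s = src_std[OF c(1)] rng_std[OF c(1)] std_unit[OF w(1), of j] std_unit[OF w(2), of i]
      src_std[OF u(1)] src_std[OF u(2)] rng_std[OF u(1)] rng_std[OF u(2)]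
      src_std[OF chart_ginv[OF c(1)]] rng_std[OF chart_ginv[OF c(1)]]
    note f = c(1)[unfolded chart_def]
    show "src germ_groupoid X \<in> arr germ_groupoid" "rng germ_groupoid X \<in> arr germ_groupoid"
      "src germ_groupoid (src germ_groupoid X) = src germ_groupoid X"
      "rng germ_groupoid (src germ_groupoid X) = src germ_groupoid X"
      "src germ_groupoid (rng germ_groupoid X) = rng germ_groupoid X"
      "rng germ_groupoid (rng germ_groupoid X) = rng germ_groupoid X"
      using c s u by (simp_all add: std_arr)
    show "mul germ_groupoid X (src germ_groupoid X) = X"
      using c s mul_std[OF c(1) u(1)] mul_src[of f] f by simp
    show "mul germ_groupoid (rng germ_groupoid X) X = X"
      using c s mul_std[OF u(2) c(1)] rng_mul_self[of f] f by simp
    show "ginv germ_groupoid X \<in> arr germ_groupoid"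
      "src germ_groupoid (ginv germ_groupoid X) = rng germ_groupoid X"
      "rng germ_groupoid (ginv germ_groupoid X) = src germ_groupoid X"
      using c s ginv_std[OF c(1)] std_arr[OF chart_ginv[OF c(1)]] by simp_all
    show "mul germ_groupoid (ginv germ_groupoid X) X = src germ_groupoid X"
      "mul germ_groupoid X (ginv germ_groupoid X) = rng germ_groupoid X"
      using c s ginv_std[OF c(1)] mul_std[OF chart_ginv[OF c(1)] c(1)] mul_std[OF c(1) chart_ginv[OF c(1)]] f
      by (simp_all add: ginv_mul mul_ginv)
  }
  { fix X Y assume XY: "X \<in> arr germ_groupoid" "Y \<in> arr germ_groupoid"
      "src germ_groupoid X = rng germ_groupoid Y"
    obtain x i f y j g w k where c: "chart x i f y j" "chart y j g w k"
      "X = std x i f y j" "Y = std y j g w k" using germ_compE[OF XY] .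
    show "mul germ_groupoid X Y \<in> arr germ_groupoid"
      "src germ_groupoid (mul germ_groupoid X Y) = src germ_groupoid Y"
      "rng germ_groupoid (mul germ_groupoid X Y) = rng germ_groupoid X"
      using c mul_std[OF c(1,2)] chart_mul[OF c(1,2)] by (simp_all add: std_arr src_std rng_std)
  }
  fix X Y Z assume XY: "X \<in> arr germ_groupoid" "Y \<in> arr germ_groupoid" and Z: "Z \<in> arr germ_groupoid"
    and sXY: "src germ_groupoid X = rng germ_groupoid Y" and YZ: "src germ_groupoid Y = rng germ_groupoid Z"
  obtain z' k' h w l where h: "chart z' k' h w l" "Z = std z' k' h w l" using germ_arrE[OF Z] .
  \<comment> \<open>With \<open>k'\<close> as the bound, \<open>Y\<close> ends at a level that
    \<open>Z\<close> can be bumped to, and associativity reduces to that of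
    \<open>G\<close>.\<close>
  obtain x i f y j g z k where c: "chart x i f y j" "chart y j g z k"
    "X = std x i f y j" "Y = std y j g z k" "k' \<le> k" using germ_compE[OF XY sXY, of k'] by metis
  have z: "z' = z"
    using YZ c h germ_unit_inject[of z z'] by (simp add: src_std rng_std chart_def)
  define h' where "h' = res_path h (subsequence w l (l + (k - k')))"
  have h': "chart z k h' w (l + (k - k'))" "Z = std z k h' w (l + (k - k'))"
    unfolding h'_def using chart_bump[OF h(1), of "l + (k - k')"] std_bump[OF h(1), of "l + (k - k')"] h(2) c(5) z
    by simp_all
  show "mul germ_groupoid (mul germ_groupoid X Y) Z = mul germ_groupoid X (mul germ_groupoid Y Z)"
    unfolding c(3,4) h'(2) mul_std[OF c(1,2)] mul_std[OF c(2) h'(1)]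
      mul_std[OF chart_mul[OF c(1,2)] h'(1)] mul_std[OF c(1) chart_mul[OF c(2) h'(1)]]
    using c h' by (subst mul_assoc) (auto simp: chart_def)
qed

section \<open>The topologies of the boundary and of the germ groupoid\<close>

lemma openin_boundary_iff:
  "openin boundary U \<longleftrightarrow> U \<subseteq> infinite_paths \<and>
    (\<forall>w\<in>U. \<exists>n. \<forall>z\<in>infinite_paths. prefix n z = prefix n w \<longrightarrow> z \<in> U)"
    (is "_ \<longleftrightarrow> ?R U")
proof
  assume "openin boundary U"
  then have "generate_topology_on (cylinder ` paths) U"
    by (simp add: boundary_def openin_topology_generated_by_iff)
  then show "?R U"
  proof induction
    case (Int a b)
    show ?case
    proof (intro conjI ballI)
      fix w assume w: "w \<in> a \<inter> b"
      obtain n n' where "\<forall>z\<in>infinite_paths. prefix n z = prefix n w \<longrightarrow> z \<in> a"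
        "\<forall>z\<in>infinite_paths. prefix n' z = prefix n' w \<longrightarrow> z \<in> b" using Int w by blast
      then show "\<exists>n. \<forall>z\<in>infinite_paths. prefix n z = prefix n w \<longrightarrow> z \<in> a \<inter> b"
        unfolding prefix_eq_iff by (intro exI[of _ "max n n'"]) auto
    qed (use Int in auto)
  next
    case (UN K)
    then show ?case by (meson Sup_least UnionE UnionI)
  next
    case (Basis s)
    then obtain v p where p: "edge_path v p" "s = cylinder (v, p)" by (auto simp: paths_def)
    show ?case
    proof (intro conjI ballI)
      fix w assume "w \<in> s"
      then have w: "w \<in> infinite_paths" "head E (w 0) = v" "prefix (length p) w = p"
        using p by (auto simp: cylinder_eq)
      \<comment> \<open>One letter more than \<open>length p\<close> is compared: for empty
        \<open>p\<close> it is the first edge that fixes the range vertex.\<close>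
      have "z \<in> s" if z: "z \<in> infinite_paths" "prefix (Suc (length p)) z = prefix (Suc (length p)) w" for z
      proof -
        have "z 0 = w 0" "prefix (length p) z = prefix (length p) w"
          using z(2) unfolding prefix_eq_iff by auto
        then show ?thesis using z w p by (simp add: cylinder_eq)
      qed
      then show "\<exists>n. \<forall>z\<in>infinite_paths. prefix n z = prefix n w \<longrightarrow> z \<in> s" by blast
    qed (use p in \<open>auto simp: cylinder_eq\<close>)
  qed auto
next
  assume R: "?R U"
  then obtain n where n: "\<And>w z. w \<in> U \<Longrightarrow> z \<in> infinite_paths \<Longrightarrow> prefix (n w) z = prefix (n w) w \<Longrightarrow> z \<in> U"
    by metis
  have path: "edge_path (head E (w 0)) (prefix m w)" if "w \<in> U" for w m
    using R that edge_path_subsequence[of w 0 m] by auto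
  have "U = \<Union> ((\<lambda>w. cylinder (head E (w 0), prefix (n w) w)) ` U)"
    using R n by (auto simp: cylinder_eq[OF path])
  moreover have "openin boundary (\<Union> ((\<lambda>w. cylinder (head E (w 0), prefix (n w) w)) ` U))"
    unfolding boundary_def
    by (intro openin_Union) (auto intro!: topology_generated_by_Basis imageI simp: paths_def path)
  ultimately show "openin boundary U" by simp
qed

lemma openin_dom_of:
  assumes "a \<in> semigroup_elems"
  shows "openin boundary (dom_of a)"
proof (cases a)
  case (Some b)
  then obtain p g q where "a = Some (p, g, q)" "q \<in> paths" using assms by (auto simp: semigroup_elems_def)
  then show ?thesis unfolding boundary_def by (auto intro: topology_generated_by_Basis)
qed simp

lemma germ_pairs_local:
  assumes "(a, w) \<in> germ_pairs"
  obtains n where "\<And>z. z \<in> infinite_paths \<Longrightarrow> prefix n z = prefix n w \<Longrightarrow> (a, z) \<in> germ_pairs"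
proof -
  have "a \<in> semigroup_elems" "w \<in> dom_of a" using assms by (auto simp: germ_pairs_def)
  then show ?thesis using openin_dom_of[of a] that unfolding openin_boundary_iff germ_pairs_def by blast
qed

text \<open>The idempotent witnessing the equality at \<open>w\<close> is a witness at all nearby
  points too, since its domain is open.\<close>

lemma germ_eq_local:
  assumes a: "(a, w) \<in> germ_pairs" and b: "(b, w) \<in> germ_pairs" and eq: "germ a w = germ b w"
  obtains n where "\<And>z. z \<in> infinite_paths \<Longrightarrow> prefix n z = prefix n w \<Longrightarrow>
    (a, z) \<in> germ_pairs \<and> (b, z) \<in> germ_pairs \<and> germ a z = germ b z"
proof -
  obtain e where e: "e \<in> idempotents" "w \<in> dom_of e" "semigroup_mult a e = semigroup_mult b e"
    using eq germ_eq_iff[OF a b] by (auto simp: germ_rel_def)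
  have "openin boundary (dom_of e)" using e(1) openin_dom_of by (auto simp: idempotents_def)
  then obtain n where n: "\<And>z. z \<in> infinite_paths \<Longrightarrow> prefix n z = prefix n w \<Longrightarrow> z \<in> dom_of e"
    using e(2) unfolding openin_boundary_iff by blast
  obtain n1 where n1: "\<And>z. z \<in> infinite_paths \<Longrightarrow> prefix n1 z = prefix n1 w \<Longrightarrow> (a, z) \<in> germ_pairs"
    using germ_pairs_local[OF a] by blast
  obtain n2 where n2: "\<And>z. z \<in> infinite_paths \<Longrightarrow> prefix n2 z = prefix n2 w \<Longrightarrow> (b, z) \<in> germ_pairs"
    using germ_pairs_local[OF b] by blast
  show ?thesis
  proof (rule that[of "n + n1 + n2"])
    fix z assume z: "z \<in> infinite_paths" "prefix (n + n1 + n2) z = prefix (n + n1 + n2) w"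
    have "z \<in> dom_of e" and az: "(a, z) \<in> germ_pairs" and bz: "(b, z) \<in> germ_pairs"
      using z n[of z] n1[of z] n2[of z] unfolding prefix_eq_iff by auto
    then have "((a, z), (b, z)) \<in> germ_rel" using e by (auto simp: germ_rel_def)
    then show "(a, z) \<in> germ_pairs \<and> (b, z) \<in> germ_pairs \<and> germ a z = germ b z"
      using germ_eq_iff[OF az bz] az bz by simp
  qed
qed

lemma germ_eq_imp_eq: "(a, w) \<in> germ_pairs \<Longrightarrow> (b, z) \<in> germ_pairs \<Longrightarrow> germ a w = germ b z \<Longrightarrow> w = z"
  by (auto simp: germ_eq_iff germ_rel_def)

text \<open>Openness may be tested with any representative \<open>a\<close>. A basic open set
  contains the germ through some other triple \<open>b\<close>, but \<open>a\<close> and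
  \<open>b\<close> have equal germs near \<open>w\<close>.\<close>

lemma openin_germ_groupoid_local:
  assumes V: "openin (gtop germ_groupoid) V" and a: "(a, w) \<in> germ_pairs" "germ a w \<in> V"
  obtains n where "\<And>z. z \<in> infinite_paths \<Longrightarrow> prefix n z = prefix n w \<Longrightarrow> (a, z) \<in> germ_pairs \<and> germ a z \<in> V"
proof -
  have "generate_topology_on
      {{germ a w | w. w \<in> U} | a U. a \<in> semigroup_elems \<and> openin boundary U \<and> U \<subseteq> dom_of a} V"
    using V by (simp add: germ_groupoid_def openin_topology_generated_by_iff)
  then have "\<exists>n. \<forall>z. z \<in> infinite_paths \<and> prefix n z = prefix n w \<longrightarrow> (a, z) \<in> germ_pairs \<and> germ a z \<in> V"
    using a(2)
  proof induction
    case (Int V V')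
    then obtain n n' where "\<forall>z. z \<in> infinite_paths \<and> prefix n z = prefix n w \<longrightarrow> (a, z) \<in> germ_pairs \<and> germ a z \<in> V"
      "\<forall>z. z \<in> infinite_paths \<and> prefix n' z = prefix n' w \<longrightarrow> (a, z) \<in> germ_pairs \<and> germ a z \<in> V'" by auto
    then show ?case unfolding prefix_eq_iff by (intro exI[of _ "max n n'"]) auto
  next
    case (UN K)
    then show ?case by (meson UnionE UnionI)
  next
    case (Basis s)
    then obtain b U where b: "b \<in> semigroup_elems" "openin boundary U" "U \<subseteq> dom_of b"
      and s: "s = {germ b w | w. w \<in> U}" by blast
    then obtain w' where w': "germ a w = germ b w'" "w' \<in> U" using Basis by blast
    have "(b, w') \<in> germ_pairs" using b w' by (auto simp: germ_pairs_def)
    then have "w' = w" using germ_eq_imp_eq[OF a(1)] w' by simp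
    note w' = w'[unfolded this]
    have bw: "(b, w) \<in> germ_pairs" using b w' by (auto simp: germ_pairs_def)
    obtain n where n: "\<And>z. z \<in> infinite_paths \<Longrightarrow> prefix n z = prefix n w \<Longrightarrow>
      (a, z) \<in> germ_pairs \<and> (b, z) \<in> germ_pairs \<and> germ a z = germ b z"
      using germ_eq_local[OF a(1) bw w'(1)] by blast
    obtain n' where n': "\<And>z. z \<in> infinite_paths \<Longrightarrow> prefix n' z = prefix n' w \<Longrightarrow> z \<in> U"
      using b(2) w'(2) unfolding openin_boundary_iff by blast
    show ?case
    proof (intro exI[of _ "n + n'"] allI impI)
      fix z assume z: "z \<in> infinite_paths \<and> prefix (n + n') z = prefix (n + n') w"
      have "prefix n z = prefix n w" "prefix n' z = prefix n' w" using z unfolding prefix_eq_iff by auto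
      then show "(a, z) \<in> germ_pairs \<and> germ a z \<in> s" using n n' z unfolding s by blast
    qed
  qed auto
  then show ?thesis using that by blast
qed

text \<open>Conversely, one representative per germ suffices, because the germs of \<open>a\<close>
  at the points of its domain sharing a prefix with \<open>w\<close> form a basic open set.\<close>

lemma openin_germ_groupoidI:
  assumes "\<And>X. X \<in> V \<Longrightarrow> \<exists>a w n. (a, w) \<in> germ_pairs \<and> X = germ a w \<and>
    (\<forall>z. (a, z) \<in> germ_pairs \<and> prefix n z = prefix n w \<longrightarrow> germ a z \<in> V)"
  shows "openin (gtop germ_groupoid) V"
proof (subst openin_subopen, intro ballI)
  fix X assume "X \<in> V"
  then obtain a w n where a: "(a, w) \<in> germ_pairs" "X = germ a w"
    and n: "\<And>z. (a, z) \<in> germ_pairs \<Longrightarrow> prefix n z = prefix n w \<Longrightarrow> germ a z \<in> V"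
    using assms by blast
  define U where "U = {z \<in> dom_of a. prefix n z = prefix n w}"
  have ae: "a \<in> semigroup_elems" "w \<in> dom_of a" using a by (auto simp: germ_pairs_def)
  have "openin boundary U"
    unfolding openin_boundary_iff
  proof (intro conjI ballI)
    fix u assume "u \<in> U"
    then have "(a, u) \<in> germ_pairs" "prefix n u = prefix n w" using ae by (auto simp: U_def germ_pairs_def)
    then obtain m where m: "\<And>z. z \<in> infinite_paths \<Longrightarrow> prefix m z = prefix m u \<Longrightarrow> (a, z) \<in> germ_pairs"
      using germ_pairs_local by blast
    show "\<exists>n. \<forall>z\<in>infinite_paths. prefix n z = prefix n u \<longrightarrow> z \<in> U"
    proof (intro exI[of _ "m + n"] ballI impI)
      fix z assume z: "z \<in> infinite_paths" "prefix (m + n) z = prefix (m + n) u"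
      have "prefix m z = prefix m u" "prefix n z = prefix n u" using z(2) unfolding prefix_eq_iff by auto
      then show "z \<in> U" using m[OF z(1)] \<open>prefix n u = _\<close> by (simp add: U_def germ_pairs_def)
    qed
  next
    show "U \<subseteq> infinite_paths"
      using openin_dom_of[OF ae(1)] unfolding openin_boundary_iff U_def by auto
  qed
  moreover have "U \<subseteq> dom_of a" by (auto simp: U_def)
  ultimately have "openin (gtop germ_groupoid) {germ a z | z. z \<in> U}"
    unfolding germ_groupoid_def top_groupoid.simps using ae
    by (intro topology_generated_by_Basis) blast
  moreover have "X \<in> {germ a z | z. z \<in> U}" using a ae by (auto simp: U_def)
  moreover have "{germ a z | z. z \<in> U} \<subseteq> V" using n ae by (auto simp: U_def germ_pairs_def)
  ultimately show "\<exists>T. openin (gtop germ_groupoid) T \<and> X \<in> T \<and> T \<subseteq> V" by blast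
qed

lemma topspace_germ_groupoid: "topspace (gtop germ_groupoid) = arr germ_groupoid"
proof
  have "germ a w \<in> arr germ_groupoid" if "a \<in> semigroup_elems" "w \<in> U" "U \<subseteq> dom_of a" for a w U
    using that by (intro germ_arr) (auto simp: germ_pairs_def)
  then show "topspace (gtop germ_groupoid) \<subseteq> arr germ_groupoid"
    by (auto simp: germ_groupoid_def topology_generated_by_topspace)
  have "openin (gtop germ_groupoid) (arr germ_groupoid)"
    by (rule openin_germ_groupoidI) (metis germ_arrE germ_arr std_def tri_germ_pairs)
  then show "arr germ_groupoid \<subseteq> topspace (gtop germ_groupoid)" by (rule openin_subset)
qed

end

section \<open>Measurability and growth\<close>

lemma space_borel_groupoid: "space (borel_groupoid G) = topspace (gtop G)"
  unfolding borel_groupoid_def using openin_subset by (intro space_measure_of) auto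

lemma openin_imp_borel_groupoid: "openin (gtop G) U \<Longrightarrow> U \<in> sets (borel_groupoid G)"
  unfolding borel_groupoid_def using openin_subset by (subst sets_measure_of) auto

text \<open>Adding a bisection \<open>B\<close> to a union \<open>W\<close> adds at most one arrow
  to a fibre, as the range is injective on \<open>B\<close>. It adds one exactly over the ranges of
  \<open>B\<close> that are not ranges of \<open>B \<inter> W\<close>, and the saturations of both
  sets are open.\<close>

lemma card_fibre_measurable:
  fixes G :: "('a, 'm) top_groupoid_scheme"
  assumes "finite \<B>" "\<And>B. B \<in> \<B> \<Longrightarrow> openin (gtop G) B" "\<And>B. B \<in> \<B> \<Longrightarrow> inj_on (rng G) B"
    and sat: "\<And>V. openin (gtop G) V \<Longrightarrow> openin (gtop G) {g \<in> topspace (gtop G). \<exists>t\<in>V. rng G t = rng G g}"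
  shows "(\<lambda>g. real (card {t \<in> \<Union>\<B>. rng G t = rng G g})) \<in> borel_measurable (borel_groupoid G) \<and>
    (\<forall>x. finite {t \<in> \<Union>\<B>. rng G t = x})"
  using assms(1-3)
proof (induction \<B> rule: finite_induct)
  case (insert B \<B>)
  define S where "S V = {g \<in> topspace (gtop G). \<exists>t\<in>V. rng G t = rng G g}" for V
  define W where "W = \<Union>\<B>"
  have IH: "(\<lambda>g. real (card {t \<in> W. rng G t = rng G g})) \<in> borel_measurable (borel_groupoid G)"
    "finite {t \<in> W. rng G t = x}" for x
    using insert unfolding W_def by auto
  have B: "openin (gtop G) B" "inj_on (rng G) B" "openin (gtop G) W"
    using insert by (auto simp: W_def)
  then have S: "S B - S (B \<inter> W) \<in> sets (borel_groupoid G)"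
    unfolding S_def by (intro sets.Diff openin_imp_borel_groupoid sat openin_Int)
  have split: "{t \<in> \<Union>(insert B \<B>). rng G t = x} = {t \<in> W. rng G t = x} \<union> {t \<in> B - W. rng G t = x}" for x
    by (auto simp: W_def)
  have finB: "finite {t \<in> B - W. rng G t = x}" for x
    by (rule finite_imageD[of "rng G"]) (use B(2) in \<open>auto simp: inj_on_def intro: finite_subset[of _ "{x}"]\<close>)
  have cardB: "real (card {t \<in> B - W. rng G t = rng G g}) = indicator (S B - S (B \<inter> W)) g"
    if g: "g \<in> topspace (gtop G)" for g
  proof (cases "g \<in> S B")
    case True
    then obtain t0 where t0: "t0 \<in> B" "rng G t0 = rng G g" by (auto simp: S_def)
    have eq: "t = t0" if "t \<in> B" "rng G t = rng G g" for t
      using that t0 B(2) by (auto simp: inj_on_def)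
    show ?thesis
    proof (cases "t0 \<in> W")
      case True
      then have "{t \<in> B - W. rng G t = rng G g} = {}" "g \<in> S (B \<inter> W)"
        using eq t0 g unfolding S_def by blast+
      then show ?thesis by (simp only: card.empty) simp
    next
      case False
      then have *: "{t \<in> B - W. rng G t = rng G g} = {t0}" "g \<notin> S (B \<inter> W)"
        using eq t0 g unfolding S_def by blast+
      show ?thesis unfolding *(1) using *(2) True by simp
    qed
  next
    case False
    then have "{t \<in> B - W. rng G t = rng G g} = {}" using g by (auto simp: S_def)
    then show ?thesis using False by (simp only: card.empty) simp
  qed
  have "real (card {t \<in> \<Union>(insert B \<B>). rng G t = rng G g})
    = real (card {t \<in> W. rng G t = rng G g}) + indicator (S B - S (B \<inter> W)) g"
    if g: "g \<in> space (borel_groupoid G)" for g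
    unfolding split cardB[OF g[unfolded space_borel_groupoid], symmetric]
    by (subst card_Un_disjoint) (use IH(2) finB in auto)
  moreover have "(\<lambda>g. real (card {t \<in> W. rng G t = rng G g}) + indicator (S B - S (B \<inter> W)) g)
      \<in> borel_measurable (borel_groupoid G)"
    using IH(1) S by measurable
  ultimately show ?case
    unfolding split using IH(2) finB by (subst measurable_cong) (auto simp: split)
qed auto

section \<open>Openness of the range map and the basic bisections\<close>

context self_similar_action
begin

lemma tri_inject:
  assumes "tri x i f w j = tri x' i' f' w' j'"
  shows "i = i'" "f = f'" "j = j'" "prefix i x = prefix i x'" "prefix j w = prefix j w'"
proof -
  have p: "prefix i x = prefix i' x'" and q: "prefix j w = prefix j' w'" and f: "f = f'"
    using assms by (auto simp: tri_def)
  show "i = i'" using arg_cong[OF p, of length] by simp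
  then show "prefix i x = prefix i x'" using p by simp
  show "j = j'" using arg_cong[OF q, of length] by simp
  then show "prefix j w = prefix j w'" using q by simp
  show "f = f'" by (rule f)
qed

text \<open>A triple remembers only prefixes of its two points, so at another point \<open>z\<close>
  of the domain it belongs to a chart with another image \<open>x1\<close>.\<close>

lemma pair_triE:
  assumes "(tri x i f w j, z) \<in> germ_pairs"
  obtains x1 where "chart x1 i f z j" "tri x1 i f z j = tri x i f w j"
proof -
  obtain x1 i1 f1 j1 where c: "chart x1 i1 f1 z j1" and eq: "tri x i f w j = tri x1 i1 f1 z j1"
    using assms by (rule germ_pairsE)
  note t = tri_inject[OF eq]
  show ?thesis using c eq unfolding t(1-3)[symmetric] by (intro that) auto
qed

text \<open>A quantitative form of continuity: \<open>m\<close> further letters of the source fix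
  \<open>m\<close> further letters of the image.\<close>

lemma chart_prefix:
  assumes c: "chart x i f w j" and c1: "chart x1 i f z j"
    and eq: "prefix i x1 = prefix i x" "prefix (j + m) z = prefix (j + m) w"
  shows "prefix (i + m) x1 = prefix (i + m) x"
proof -
  have "subsequence z j (j + m) = subsequence w j (j + m)"
    using arg_cong[OF eq(2), of "drop j"] by simp
  then have "subsequence x1 i (i + m) = subsequence x i (i + m)"
    using act_path_chart[OF c, of "j + m"] act_path_chart[OF c1, of "j + m"] by simp
  then show ?thesis using eq(1) by (simp add: subsequence_append)
qed

text \<open>The range map is continuous and open. If a germ near \<open>X\<close> has range
  \<open>x1\<close> close to \<open>x\<close>, the inverse of the triple of \<open>t\<close> takes
  \<open>x1\<close> to a point \<open>z'\<close> close to \<open>w'\<close>, where the triple of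
  \<open>t\<close> still has its germ in \<open>V\<close>, now with range \<open>x1\<close>.\<close>

lemma openin_rng_saturation:
  assumes V: "openin (gtop germ_groupoid) V"
  shows "openin (gtop germ_groupoid)
    {g \<in> topspace (gtop germ_groupoid). \<exists>t\<in>V. rng germ_groupoid t = rng germ_groupoid g}"
proof (rule openin_germ_groupoidI)
  fix X assume "X \<in> {g \<in> topspace (gtop germ_groupoid). \<exists>t\<in>V. rng germ_groupoid t = rng germ_groupoid g}"
  then obtain t where X: "X \<in> arr germ_groupoid" and t: "t \<in> V" and r: "rng germ_groupoid t = rng germ_groupoid X"
    by (auto simp: topspace_germ_groupoid)
  have "t \<in> arr germ_groupoid" using openin_subset[OF V] t by (auto simp: topspace_germ_groupoid)
  then obtain x' i' f' w' j' where c': "chart x' i' f' w' j'" and t': "t = std x' i' f' w' j'"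
    by (rule germ_arrE)
  obtain x i f w j where c: "chart x i f w j" and X': "X = std x i f w j" using X by (rule germ_arrE)
  have "x' = x" using r c c' germ_unit_inject[of x' x] by (simp add: t' X' rng_std chart_def)
  note c' = c'[unfolded this] and t' = t'[unfolded this]
  obtain n' where n': "\<And>z. z \<in> infinite_paths \<Longrightarrow> prefix n' z = prefix n' w' \<Longrightarrow>
      germ (tri x i' f' w' j') z \<in> V"
    using openin_germ_groupoid_local[OF V tri_germ_pairs[OF c']] t unfolding t' std_def by metis
  obtain n1 where n1: "\<And>z. z \<in> infinite_paths \<Longrightarrow> prefix n1 z = prefix n1 x \<Longrightarrow>
      (tri w' j' (ginv G f') x i', z) \<in> germ_pairs"
    using germ_pairs_local[OF tri_germ_pairs[OF chart_ginv[OF c']]] by metis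
  \<comment> \<open>\<open>n1\<close> keeps \<open>x1\<close> in the domain of the inverse triple,
    while i' + n' common letters of \<open>x1\<close> and \<open>x\<close> yield j' + n' common
    letters of \<open>z'\<close> and \<open>w'\<close>.\<close>
  define m where "m = i' + n' + n1"
  show "\<exists>a w n. (a, w) \<in> germ_pairs \<and> X = germ a w \<and>
    (\<forall>z. (a, z) \<in> germ_pairs \<and> prefix n z = prefix n w \<longrightarrow>
       germ a z \<in> {g \<in> topspace (gtop germ_groupoid). \<exists>t\<in>V. rng germ_groupoid t = rng germ_groupoid g})"
  proof (intro exI conjI allI impI)
    show "(tri x i f w j, w) \<in> germ_pairs" by (rule tri_germ_pairs[OF c])
    show "X = germ (tri x i f w j) w" using X' by (simp add: std_def)
    fix z assume z: "(tri x i f w j, z) \<in> germ_pairs \<and> prefix (j + m) z = prefix (j + m) w"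
    obtain x1 where c1: "chart x1 i f z j" and e1: "tri x1 i f z j = tri x i f w j"
      using conjunct1[OF z] by (rule pair_triE)
    have x1: "prefix (i + m) x1 = prefix (i + m) x" "x1 \<in> infinite_paths"
      using chart_prefix[OF c c1 tri_inject(4)[OF e1] conjunct2[OF z]] c1 by (auto simp: chart_def)
    have "prefix n1 x1 = prefix n1 x" and px: "prefix (i' + n') x1 = prefix (i' + n') x"
      using x1(1) unfolding prefix_eq_iff m_def by auto
    then have "(tri w' j' (ginv G f') x i', x1) \<in> germ_pairs" using n1 x1 by blast
    then obtain z' where c2: "chart z' j' (ginv G f') x1 i'"
      and e2: "tri z' j' (ginv G f') x1 i' = tri w' j' (ginv G f') x i'" by (rule pair_triE)
    have c3: "chart x1 i' f' z' j'" using chart_ginv[OF c2] c' ginv_ginv[of f'] by (simp add: chart_def)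
    have "prefix (j' + n') z' = prefix (j' + n') w'"
      by (rule chart_prefix[OF chart_ginv[OF c'] c2 tri_inject(4)[OF e2] px])
    then have "prefix n' z' = prefix n' w'" unfolding prefix_eq_iff by auto
    moreover have "z' \<in> infinite_paths" using c3 by (simp add: chart_def)
    ultimately have "germ (tri x i' f' w' j') z' \<in> V" by (rule n'[rotated])
    moreover have "tri x i' f' w' j' = tri x1 i' f' z' j'" using e2 by (simp add: tri_def)
    ultimately have V1: "std x1 i' f' z' j' \<in> V" by (simp add: std_def)
    have "germ (tri x i f w j) z = std x1 i f z j" by (simp add: std_def e1)
    moreover have "rng germ_groupoid (std x1 i' f' z' j') = rng germ_groupoid (std x1 i f z j)"
      using c1 c3 by (simp add: rng_std)
    ultimately show "germ (tri x i f w j) z \<in> {g \<in> topspace (gtop germ_groupoid).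
        \<exists>t\<in>V. rng germ_groupoid t = rng germ_groupoid g}"
      using V1 std_arr[OF c1] by (auto simp: topspace_germ_groupoid)
  qed
qed

text \<open>The germs of a triple (p, g, s(g)) over its whole domain. As the right path is trivial,
  the source point is the inverse of \<open>g\<close> applied to a tail of the range point.\<close>

definition bisection :: "'e list \<Rightarrow> 'g \<Rightarrow> ('g, 'e) germ set" where
  "bisection p g = {std x (length p) g w 0 | x w. chart x (length p) g w 0 \<and> prefix (length p) x = p}"

lemma openin_bisection: "openin (gtop germ_groupoid) (bisection p g)"
proof (rule openin_germ_groupoidI)
  fix X assume "X \<in> bisection p g"
  then obtain x w where c: "chart x (length p) g w 0" "prefix (length p) x = p" "X = std x (length p) g w 0"
    by (auto simp: bisection_def)
  have "germ (tri x (length p) g w 0) z \<in> bisection p g" if z: "(tri x (length p) g w 0, z) \<in> germ_pairs" for z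
  proof -
    obtain x1 where c1: "chart x1 (length p) g z 0" and e1: "tri x1 (length p) g z 0 = tri x (length p) g w 0"
      using z by (rule pair_triE)
    then show ?thesis
      unfolding bisection_def using tri_inject(4)[OF e1] c(2)
      by (intro CollectI exI[of _ x1] exI[of _ z]) (simp add: std_def)
  qed
  then show "\<exists>a w n. (a, w) \<in> germ_pairs \<and> X = germ a w \<and>
    (\<forall>z. (a, z) \<in> germ_pairs \<and> prefix n z = prefix n w \<longrightarrow> germ a z \<in> bisection p g)"
    using tri_germ_pairs[OF c(1)] c(3) unfolding std_def by blast
qed

lemma suffix_eq_chart: "chart x i f w j \<Longrightarrow> suffix j w = act_infinite (ginv G f) (suffix i x)"
  using chart_ginv[of x i f w j] by (simp add: chart_def)

lemma inj_on_rng_bisection: "inj_on (rng germ_groupoid) (bisection p g)"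
proof (rule inj_onI)
  fix X Y assume X: "X \<in> bisection p g" and Y: "Y \<in> bisection p g"
    and eq: "rng germ_groupoid X = rng germ_groupoid Y"
  obtain x w where c: "chart x (length p) g w 0" "X = std x (length p) g w 0"
    using X by (auto simp: bisection_def)
  obtain x' w' where c': "chart x' (length p) g w' 0" "Y = std x' (length p) g w' 0"
    using Y by (auto simp: bisection_def)
  have x: "x = x'" using eq c c' germ_unit_inject[of x x'] by (simp add: rng_std chart_def)
  moreover have "w = w'" using suffix_eq_chart[OF c(1)] suffix_eq_chart[OF c'(1)] x by simp
  ultimately show "X = Y" using c c' by simp
qed

end

section \<open>Growth of the Foelner sets and amenability\<close>

context contracting_self_similar_action
begin

text \<open>
  The fibre of \<open>folner_set k j\<close> over \<open>x\<close> consists of germs from the \<open>core_pow j\<close>-orbit of the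
  \<open>k\<close>-th tail of \<open>x\<close>. Since all products of two elements of the core contract to the core within
  \<open>l\<close> steps, products of \<open>2 ^ i\<close> elements do so within \<open>l * Suc i\<close> steps. This bounds the
  fibres polynomially in \<open>j\<close>, uniformly in \<open>k\<close> and \<open>x\<close>.
\<close>

definition core :: "'g set" where
  "core = units G \<union> nucleus \<union> ginv G ` nucleus"

lemma nucleus: "finite nucleus" "nucleus \<subseteq> arr G"
  "g \<in> arr G \<Longrightarrow> \<exists>n. \<forall>p. edge_path (src G g) p \<and> n \<le> length p \<longrightarrow> res_path g p \<in> nucleus"
  using nucleus_least(1)[OF contracting] by (auto simp: contracting_core_def)

lemma finite_units: "finite (units G)"
  using finite_verts verts_eq_units by simp

lemma core: "finite core" "g \<in> core \<Longrightarrow> g \<in> arr G" "units G \<subseteq> core" "g \<in> core \<Longrightarrow> ginv G g \<in> core"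
  using nucleus(1,2) finite_units
  by (auto simp: core_def units_arr ginv_closed ginv_unit ginv_ginv)

lemma res_path_in_core:
  assumes "finite S" "S \<subseteq> arr G"
  shows "\<exists>n. \<forall>g\<in>S. \<forall>p. edge_path (src G g) p \<and> n \<le> length p \<longrightarrow> res_path g p \<in> core"
proof -
  obtain n where n: "\<And>g p. g \<in> S \<Longrightarrow> edge_path (src G g) p \<Longrightarrow> n g \<le> length p \<Longrightarrow> res_path g p \<in> nucleus"
    using nucleus(3) assms(2) unfolding subset_iff by metis
  have "n g \<le> Max (n ` S)" if "g \<in> S" for g using assms(1) that by simp
  then show ?thesis using n unfolding core_def by (meson UnI1 UnI2 order_trans)
qed

primrec core_pow :: "nat \<Rightarrow> 'g set" where
  "core_pow 0 = units G"
| "core_pow (Suc n) = {mul G g h | g h. g \<in> core \<and> h \<in> core_pow n \<and> src G g = rng G h}"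

lemma core_pow_arr: "g \<in> core_pow n \<Longrightarrow> g \<in> arr G"
  by (induction n arbitrary: g) (auto simp: units_arr core(2) mul_closed)

lemma finite_core_pow: "finite (core_pow n)"
proof (induction n)
  case (Suc n)
  have "core_pow (Suc n) \<subseteq> (\<lambda>(g, h). mul G g h) ` (core \<times> core_pow n)" by auto
  then show ?case using core(1) Suc by (meson finite_SigmaI finite_imageI finite_subset)
qed (simp add: finite_units)

lemma core_pow_mono: "m \<le> n \<Longrightarrow> core_pow m \<subseteq> core_pow n"
proof (rule lift_Suc_mono_le)
  fix n show "core_pow n \<subseteq> core_pow (Suc n)"
  proof
    fix g assume g: "g \<in> core_pow n"
    have "rng G g \<in> core" "src G (rng G g) = rng G g" "g = mul G (rng G g) g"
      using core_pow_arr[OF g] core(3) rng_in_units by (auto simp: src_rng rng_mul_self)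
    then show "g \<in> core_pow (Suc n)" using g by (simp only: core_pow.simps) blast
  qed
qed

lemma core_pow_add:
  assumes "g \<in> core_pow (m + n)"
  obtains g1 g2 where "g1 \<in> core_pow m" "g2 \<in> core_pow n" "src G g1 = rng G g2" "g = mul G g1 g2"
proof -
  have "\<exists>g1\<in>core_pow m. \<exists>g2\<in>core_pow n. src G g1 = rng G g2 \<and> g = mul G g1 g2"
    using assms
  proof (induction m arbitrary: g)
    case 0
    then have "g \<in> arr G" using core_pow_arr by simp
    then show ?case using 0 rng_in_units
      by (intro bexI[of _ "rng G g"] bexI[of _ g]) (auto simp: src_rng rng_mul_self)
  next
    case (Suc m)
    then obtain f h where f: "f \<in> core" "h \<in> core_pow (m + n)" "src G f = rng G h" "g = mul G f h" by auto
    obtain g1 g2 where g: "g1 \<in> core_pow m" "g2 \<in> core_pow n" "src G g1 = rng G g2" "h = mul G g1 g2"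
      using Suc.IH[OF f(2)] by auto
    note a = core_pow_arr[OF g(1)] core_pow_arr[OF g(2)] core(2)[OF f(1)]
    have r: "src G f = rng G g1" using f g a by (simp add: rng_mul)
    show ?case
    proof (intro bexI conjI)
      show "mul G f g1 \<in> core_pow (Suc m)"
        using f(1) g(1) r by (simp only: core_pow.simps) blast
      show "src G (mul G f g1) = rng G g2" using a r g by (simp add: src_mul)
      show "g = mul G (mul G f g1) g2" using a r g f by (simp add: mul_assoc)
    qed (rule g)
  qed
  then show ?thesis using that by blast
qed

lemma core_pow_contracts:
  obtains l where "\<And>i g p. g \<in> core_pow (2 ^ i) \<Longrightarrow> edge_path (src G g) p \<Longrightarrow>
    length p = l * Suc i \<Longrightarrow> res_path g p \<in> core"
proof -
  define S where "S = {mul G g h | g h. g \<in> core \<and> h \<in> core \<and> src G g = rng G h}"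
  have "S \<subseteq> (\<lambda>(g, h). mul G g h) ` (core \<times> core)" by (auto simp: S_def)
  then have "finite S" using core(1) by (meson finite_SigmaI finite_imageI finite_subset)
  moreover have "S \<subseteq> arr G" by (auto simp: S_def core(2) mul_closed)
  ultimately obtain l where l: "\<And>g p. g \<in> S \<Longrightarrow> edge_path (src G g) p \<Longrightarrow> l \<le> length p \<Longrightarrow> res_path g p \<in> core"
    using res_path_in_core by meson
  have "res_path g p \<in> core" if "g \<in> core_pow (2 ^ i)" "edge_path (src G g) p" "length p = l * Suc i" for i g p
    using that
  proof (induction i arbitrary: g p)
    case 0
    \<comment> \<open>For i = 0 the arrow is a core element times a unit, and units belong to the
      core.\<close>
    then have "g \<in> S" using core(3) by (auto simp: S_def)
    then show ?case using l 0 by simp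
  next
    case (Suc i)
    have "g \<in> core_pow (2 ^ i + 2 ^ i)" using Suc.prems(1) by (simp add: mult_2)
    then obtain g1 g2 where g: "g1 \<in> core_pow (2 ^ i)" "g2 \<in> core_pow (2 ^ i)" "src G g1 = rng G g2" "g = mul G g1 g2"
      by (rule core_pow_add)
    note a = core_pow_arr[OF g(1)] core_pow_arr[OF g(2)]
    define p1 p2 where "p1 = take (l * Suc i) p" and "p2 = drop (l * Suc i) p"
    have p: "p = p1 @ p2" "length p1 = l * Suc i" "length p2 = l"
      using Suc.prems(3) by (auto simp: p1_def p2_def)
    have s: "src G g = src G g2" using a g by (simp add: src_mul)
    have e: "edge_path (src G g2) p1" "edge_path (path_src (src G g2, p1)) p2"
      using Suc.prems(2) p s by (auto simp: edge_path_append)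
    have e1: "edge_path (src G g1) (act_path g2 p1)" using edge_path_act_path[OF a(2) e(1)] g by simp
    \<comment> \<open>The letters of \<open>p1\<close> bring both halves into the core, the left one
      along the image of \<open>p1\<close> under the right one. What remains is a product of two
      core elements, which the \<open>l\<close> letters of \<open>p2\<close> deal with.\<close>
    have r: "res_path g p1 = mul G (res_path g1 (act_path g2 p1)) (res_path g2 p1)"
      using res_path_mul[OF a g(3) e(1)] g by simp
    have "res_path g1 (act_path g2 p1) \<in> core" "res_path g2 p1 \<in> core"
      using Suc.IH[OF g(1) e1] Suc.IH[OF g(2) e(1)] p(2) by auto
    moreover have "src G (res_path g1 (act_path g2 p1)) = rng G (res_path g2 p1)"
      using src_res_path[OF a(1) e1] rng_res_path[OF a(2) e(1)] g(3) by simp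
    ultimately have "res_path g p1 \<in> S" unfolding S_def r by blast
    moreover have "src G (res_path g p1) = path_src (src G g2, p1)"
      using src_res_path[of g p1] a g e s by (simp add: mul_closed)
    ultimately show ?case using l[of "res_path g p1" p2] e(2) p by (simp add: res_path_append)
  qed
  then show ?thesis using that by blast
qed

definition folner_set :: "nat \<Rightarrow> nat \<Rightarrow> ('g, 'e) germ set" where
  "folner_set k j = {std x k g w 0 | x g w. chart x k g w 0 \<and> g \<in> core_pow j}"

lemma folner_set_arr: "t \<in> folner_set k j \<Longrightarrow> t \<in> arr germ_groupoid"
  by (auto simp: folner_set_def std_arr)

lemma finite_edge_lists: "finite {p. set p \<subseteq> arcs E \<and> length p = k}"
  using finite_arcs by (rule finite_lists_length_eq)

text \<open>The lists \<open>p\<close> may include some that are not paths; their bisections are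
  empty. Being a finite union of open bisections makes the set Borel and its fibres finite.\<close>

lemma folner_set_eq_Union:
  "folner_set k j = \<Union> ((\<lambda>(p, g). bisection p g) ` ({p. set p \<subseteq> arcs E \<and> length p = k} \<times> core_pow j))"
proof (intro equalityI subsetI)
  fix t assume "t \<in> folner_set k j"
  then obtain x g w where c: "chart x k g w 0" "g \<in> core_pow j" "t = std x k g w 0" by (auto simp: folner_set_def)
  have "set (prefix k x) \<subseteq> arcs E" using c(1) infinite_paths_arcs by (auto simp: chart_def)
  moreover have "t \<in> bisection (prefix k x) g" using c by (auto simp: bisection_def)
  ultimately show "t \<in> \<Union> ((\<lambda>(p, g). bisection p g) ` ({p. set p \<subseteq> arcs E \<and> length p = k} \<times> core_pow j))"
    using c(2) by (intro UnionI[of "bisection (prefix k x) g"]) (auto intro!: image_eqI[of _ _ "(prefix k x, g)"])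
qed (auto simp: folner_set_def bisection_def)

lemma openin_folner_set: "openin (gtop germ_groupoid) (folner_set k j)"
  unfolding folner_set_eq_Union by (rule openin_Union) (auto simp: openin_bisection)

lemma germ_groupoid_unitE:
  assumes "X \<in> units germ_groupoid"
  obtains x where "x \<in> infinite_paths" "X = germ_unit x"
proof -
  obtain Y where Y: "Y \<in> arr germ_groupoid" "X = src germ_groupoid Y" using assms by (auto simp: units_def)
  obtain x i f w j where c: "chart x i f w j" "Y = std x i f w j" using germ_arrE[OF Y(1)] .
  then show ?thesis using that[of w] Y by (simp add: src_std chart_def)
qed

lemma fibre_folner_set:
  assumes x: "x \<in> infinite_paths"
  shows "{t \<in> folner_set k j. rng germ_groupoid t = germ_unit x}
    = {std x k g w 0 | g w. chart x k g w 0 \<and> g \<in> core_pow j}"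
proof -
  have "rng germ_groupoid (std x' k g w 0) = germ_unit x \<longleftrightarrow> x' = x" if "chart x' k g w 0" for x' g w
    using that germ_unit_inject[OF _ x, of x'] by (simp add: rng_std chart_def)
  then show ?thesis unfolding folner_set_def by blast
qed

lemma chart_shift: "x \<in> infinite_paths \<Longrightarrow> chart x k (head E (x k)) (suffix k x) 0"
  using chart_unit[of x k] suffix_infinite_paths[of x k] by (simp add: chart_def)

text \<open>The germ of the \<open>k\<close>-fold shift at \<open>x\<close>, with a unit as its
  coordinate, always lies in the fibre over \<open>x\<close>.\<close>

lemma fibre_folner_set_nonempty:
  assumes X: "X \<in> units germ_groupoid"
  shows "{t \<in> folner_set k j. rng germ_groupoid t = X} \<noteq> {}"
proof -
  obtain x where x: "x \<in> infinite_paths" "X = germ_unit x" using X by (rule germ_groupoid_unitE)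
  have "head E (x k) \<in> core_pow j"
    using core_pow_mono[of 0 j] infinite_paths_units[OF x(1)] by auto
  then show ?thesis unfolding x(2) fibre_folner_set[OF x(1)] using chart_shift[OF x(1)] by blast
qed

text \<open>After l * Suc i letters the coordinate \<open>f\<close> of the germ lies in the core.
  The source is then recovered from these letters, since its tail is the inverse of \<open>f\<close>
  applied to a tail of \<open>x\<close>. Neither \<open>k\<close> nor \<open>x\<close> enters the
  count.\<close>

lemma card_fibre_folner_set:
  assumes X: "X \<in> units germ_groupoid" and j: "j \<le> 2 ^ i"
    and l: "\<And>i g p. g \<in> core_pow (2 ^ i) \<Longrightarrow> edge_path (src G g) p \<Longrightarrow>
      length p = l * Suc i \<Longrightarrow> res_path g p \<in> core"
  shows "card {t \<in> folner_set k j. rng germ_groupoid t = X} \<le> card (arcs E) ^ (l * Suc i) * card core"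
proof -
  obtain x where x: "x \<in> infinite_paths" "X = germ_unit x" using X by (rule germ_groupoid_unitE)
  define L where "L = l * Suc i"
  define D where "D = {p. set p \<subseteq> arcs E \<and> length p = L} \<times> core"
  \<comment> \<open>Defined on all of \<open>D\<close>, including pairs that belong to no chart; its
    image has to cover the fibre.\<close>
  define \<Phi> where "\<Phi> = (\<lambda>(p, f). std x (k + L) f (p \<frown> act_infinite (ginv G f) (suffix (k + L) x)) L)"
  have "{t \<in> folner_set k j. rng germ_groupoid t = X} \<subseteq> \<Phi> ` D"
  proof
    fix t assume "t \<in> {t \<in> folner_set k j. rng germ_groupoid t = X}"
    then obtain g w where c: "chart x k g w 0" "g \<in> core_pow j" "t = std x k g w 0"
      unfolding x(2) fibre_folner_set[OF x(1)] by blast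
    define f where "f = res_path g (prefix L w)"
    have b: "chart x (k + L) f w L" "t = std x (k + L) f w L"
      using chart_bump[OF c(1), of L] std_bump[OF c(1), of L] c(3) by (simp_all add: f_def)
    have "g \<in> core_pow (2 ^ i)" using c(2) core_pow_mono[OF j] by blast
    then have "f \<in> core" unfolding f_def using l edge_path_chart[OF c(1), of L] by (simp add: L_def)
    moreover have "set (prefix L w) \<subseteq> arcs E" using c(1) infinite_paths_arcs by (auto simp: chart_def)
    ultimately have "(prefix L w, f) \<in> D" by (simp add: D_def)
    moreover have "prefix L w \<frown> act_infinite (ginv G f) (suffix (k + L) x) = w"
      using suffix_eq_chart[OF b(1)] by (metis prefix_suffix)
    then have "t = \<Phi> (prefix L w, f)" using b(2) by (simp only: \<Phi>_def prod.case)
    ultimately show "t \<in> \<Phi> ` D" by (rule image_eqI[rotated])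
  qed
  moreover have "finite D" unfolding D_def using finite_edge_lists core(1) by blast
  moreover have "card D = card (arcs E) ^ L * card core"
    unfolding D_def card_cartesian_product using card_lists_length_eq[OF finite_arcs] by simp
  ultimately show ?thesis unfolding L_def using surj_card_le[of D _ \<Phi>] by simp
qed

text \<open>The shifts are j0 + n and i + n: they differ by the degree of \<open>h\<close>, and
  \<open>n\<close> letters bring its coordinate into the core. Left multiplication then adds one
  core factor, and so does the inverse because the core is closed under inverses.\<close>

lemma folner_set_translate:
  assumes h: "h \<in> arr germ_groupoid"
  shows "\<exists>a b. \<forall>k j.
    (\<forall>g\<in>folner_set (k + a) j. rng germ_groupoid g = src germ_groupoid h \<longrightarrow>
       mul germ_groupoid h g \<in> folner_set (k + b) (Suc j)) \<and>
    (\<forall>g\<in>folner_set (k + b) j. rng germ_groupoid g = rng germ_groupoid h \<longrightarrow>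
       mul germ_groupoid (ginv germ_groupoid h) g \<in> folner_set (k + a) (Suc j))"
proof -
  obtain x i f y j0 where c: "chart x i f y j0" "h = std x i f y j0" using germ_arrE[OF h] .
  have "f \<in> arr G" using c by (simp add: chart_def)
  then obtain n where n: "\<And>p. edge_path (src G f) p \<Longrightarrow> n \<le> length p \<Longrightarrow> res_path f p \<in> core"
    using res_path_in_core[of "{f}"] by auto
  have step: "mul germ_groupoid (std x i f y k) g \<in> folner_set i (Suc j)"
    if f: "chart x i f y k" "f \<in> core" and t: "g \<in> folner_set k j" "rng germ_groupoid g = germ_unit y"
    for x i f y k j g
  proof -
    obtain y' c w where g: "chart y' k c w 0" "c \<in> core_pow j" "g = std y' k c w 0"
      using t(1) by (auto simp: folner_set_def)
    have "y' = y" using f(1) t(2) g germ_unit_inject[of y' y] by (simp add: rng_std chart_def)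
    note g = g[unfolded this]
    have "src G f = rng G c" using f(1) g(1) by (simp add: chart_def)
    then have "mul G f c \<in> core_pow (Suc j)" using f(2) g(2) by (simp only: core_pow.simps) blast
    then show ?thesis
      unfolding g(3) mul_std[OF f(1) g(1)] folner_set_def using chart_mul[OF f(1) g(1)] by blast
  qed
  \<comment> \<open>The representative of \<open>h\<close> depends on \<open>k\<close>: it must
    start at the level at which members of \<open>folner_set (k + (j0 + n)) j\<close> end on the
    range side.\<close>
  have "\<exists>f'. chart x (k + (i + n)) f' y (k + (j0 + n)) \<and> f' \<in> core \<and> h = std x (k + (i + n)) f' y (k + (j0 + n))" for k
  proof (intro exI conjI)
    have "j0 \<le> k + (j0 + n)" "i + (k + (j0 + n) - j0) = k + (i + n)" by auto
    note b = chart_bump[OF c(1) this(1), unfolded this(2)] std_bump[OF c(1) this(1), unfolded this(2)]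
    show "chart x (k + (i + n)) (res_path f (subsequence y j0 (k + (j0 + n)))) y (k + (j0 + n))" by (rule b)
    show "h = std x (k + (i + n)) (res_path f (subsequence y j0 (k + (j0 + n)))) y (k + (j0 + n))"
      using b c(2) by simp
    show "res_path f (subsequence y j0 (k + (j0 + n))) \<in> core"
      by (rule n) (use edge_path_chart[OF c(1)] in auto)
  qed
  then obtain f' where f': "\<And>k. chart x (k + (i + n)) (f' k) y (k + (j0 + n))" "\<And>k. f' k \<in> core"
    "\<And>k. h = std x (k + (i + n)) (f' k) y (k + (j0 + n))" by metis
  show ?thesis
  proof (rule exI[of _ "j0 + n"], rule exI[of _ "i + n"], intro allI conjI ballI impI)
    fix k j g assume "g \<in> folner_set (k + (j0 + n)) j" "rng germ_groupoid g = src germ_groupoid h"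
    then show "mul germ_groupoid h g \<in> folner_set (k + (i + n)) (Suc j)"
      using step[OF f'(1,2)[of k]] f'(3)[of k] src_std[OF c(1)] c(2) by metis
  next
    fix k j g assume "g \<in> folner_set (k + (i + n)) j" "rng germ_groupoid g = rng germ_groupoid h"
    moreover have "ginv germ_groupoid h = std y (k + (j0 + n)) (ginv G (f' k)) x (k + (i + n))"
      using ginv_std[OF f'(1)[of k]] f'(3)[of k] by simp
    ultimately show "mul germ_groupoid (ginv germ_groupoid h) g \<in> folner_set (k + (j0 + n)) (Suc j)"
      using step[OF chart_ginv[OF f'(1)[of k]] core(4)[OF f'(2)]] rng_std[OF c(1)] c(2) by metis
  qed
qed

lemma le_two_power_ceiling_log: "j \<le> 2 ^ nat \<lceil>log 2 (real j + 1)\<rceil>"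
proof -
  have "real j + 1 = 2 powr (log 2 (real j + 1))" by simp
  also have "\<dots> \<le> 2 powr real (nat \<lceil>log 2 (real j + 1)\<rceil>)"
    by (intro powr_mono) (auto intro: real_nat_ceiling_ge)
  also have "\<dots> = real (2 ^ nat \<lceil>log 2 (real j + 1)\<rceil>)"
    by (subst powr_realpow) auto
  finally show ?thesis by linarith
qed

theorem amenable_germ_groupoid: "amenable germ_groupoid"
proof -
  obtain l where l: "\<And>i g p. g \<in> core_pow (2 ^ i) \<Longrightarrow> edge_path (src G g) p \<Longrightarrow>
      length p = l * Suc i \<Longrightarrow> res_path g p \<in> core"
    using core_pow_contracts by blast
  define lg where "lg j = nat \<lceil>log 2 (real j + 1)\<rceil>" for j :: nat
  \<comment> \<open>The exponent is logarithmic in \<open>j\<close>, so \<open>f\<close> grows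
    polynomially. Both uses of \<open>Suc\<close> on a cardinality keep the logarithms nonnegative
    even for empty sets.\<close>
  define f where "f j = real (Suc (card (arcs E)) ^ (l * Suc (lg j)) * Suc (card core))" for j
  define \<B> where "\<B> k j = (\<lambda>(p, g). bisection p g) ` ({p. set p \<subseteq> arcs E \<and> length p = k} \<times> core_pow j)" for k j
  have \<B>: "finite (\<B> k j)" for k j
    unfolding \<B>_def using finite_edge_lists finite_core_pow by blast
  have meas: "(\<lambda>g. real (card {t \<in> folner_set k j. rng germ_groupoid t = rng germ_groupoid g}))
      \<in> borel_measurable (borel_groupoid germ_groupoid) \<and>
    (\<forall>x. finite {t \<in> folner_set k j. rng germ_groupoid t = x})" for k j
    unfolding folner_set_eq_Union \<B>_def[symmetric]
    by (rule card_fibre_measurable[OF \<B>])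
      (auto simp: \<B>_def openin_bisection inj_on_rng_bisection openin_rng_saturation)
  have growth: "real (card {t \<in> folner_set k j. rng germ_groupoid t = x}) \<le> f j"
    if "x \<in> units germ_groupoid" for k j x
  proof -
    have "card {t \<in> folner_set k j. rng germ_groupoid t = x} \<le> card (arcs E) ^ (l * Suc (lg j)) * card core"
      unfolding lg_def by (rule card_fibre_folner_set[OF that le_two_power_ceiling_log]) (rule l)
    also have "\<dots> \<le> Suc (card (arcs E)) ^ (l * Suc (lg j)) * Suc (card core)"
      by (intro mult_le_mono power_mono) auto
    finally show ?thesis unfolding f_def of_nat_le_iff .
  qed
  have f_lim: "(\<lambda>n. ln (f n) / real n) \<longlonglongrightarrow> 0"
  proof (rule tendsto_sandwich)
    define A where "A = real l * ln (real (Suc (card (arcs E))))"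
    define B where "B = ln (real (Suc (card core)))"
    have AB: "A \<ge> 0" "B \<ge> 0" by (auto simp: A_def B_def)
    have ln_f: "ln (f n) = A * real (Suc (lg n)) + B" for n
      unfolding f_def A_def B_def of_nat_mult of_nat_power
      by (subst ln_mult) (auto simp: ln_realpow algebra_simps)
    have "real (lg n) \<le> log 2 (real n + 1) + 1" for n
      unfolding lg_def by simp
    then have "ln (f n) \<le> A * (log 2 (real n + 1) + 2) + B" for n
      unfolding ln_f using AB(1) by (intro add_right_mono mult_left_mono) (auto simp: add.commute)
    then show "\<forall>\<^sub>F n in sequentially. ln (f n) / real n \<le> A * ((log 2 (real n + 1) + 2) / real n) + B / real n"
      by (intro always_eventually allI) (simp add: divide_right_mono flip: add_divide_distrib)
    show "\<forall>\<^sub>F n in sequentially. 0 \<le> ln (f n) / real n"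
      unfolding ln_f using AB by (intro always_eventually allI) simp
    have "(\<lambda>n. (log 2 (real n + 1) + 2) / real n) \<longlonglongrightarrow> 0" "(\<lambda>n. B / real n) \<longlonglongrightarrow> 0"
      by real_asymp+
    then have "(\<lambda>n. A * ((log 2 (real n + 1) + 2) / real n) + B / real n) \<longlonglongrightarrow> A * 0 + 0"
      by (intro tendsto_intros)
    then show "(\<lambda>n. A * ((log 2 (real n + 1) + 2) / real n) + B / real n) \<longlonglongrightarrow> 0" by simp
  qed simp
  have mono: "folner_set k j \<subseteq> folner_set k (Suc j)" for k j
    using core_pow_mono[of j "Suc j", OF le_SucI[OF order_refl]] unfolding folner_set_def by blast
  show ?thesis
    by (rule amenable_of_subexponential_growth[where T = folner_set and f = f,
          OF groupoid_germ_groupoid openin_imp_borel_groupoid[OF openin_folner_set] folner_set_arr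
            conjunct1[OF meas] spec[OF conjunct2[OF meas]] fibre_folner_set_nonempty growth f_lim
            mono folner_set_translate])
qed

end

section \<open>The subgroupoid generated by the nucleus\<close>

text \<open>\<open>arr G\<close> is itself a subgroupoid containing \<open>A\<close>, so the
  intersection is over a nonempty family and stays inside \<open>arr G\<close>.\<close>

lemma subgroupoid_generated:
  assumes "groupoid G" "A \<subseteq> arr G"
  shows "subgroupoid (generated_subgroupoid G A) G" "A \<subseteq> generated_subgroupoid G A"
proof -
  interpret groupoid G by fact
  have "subgroupoid (arr G) G" by (auto simp: subgroupoid_def ginv_closed mul_closed)
  then have "generated_subgroupoid G A \<subseteq> arr G" using assms unfolding generated_subgroupoid_def by blast
  then show "subgroupoid (generated_subgroupoid G A) G"
    unfolding generated_subgroupoid_def subgroupoid_def by blast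
  show "A \<subseteq> generated_subgroupoid G A" unfolding generated_subgroupoid_def by blast
qed

lemma generated_subgroupoid_least:
  "subgroupoid K G \<Longrightarrow> A \<subseteq> K \<Longrightarrow> generated_subgroupoid G A \<subseteq> K"
  unfolding generated_subgroupoid_def by blast

text \<open>Closure under \<open>src\<close> and \<open>rng\<close> comes from closure under
  inverses and products, as sources and ranges are products of an arrow with its inverse.\<close>

lemma groupoid_subgroupoid:
  fixes G :: "'a groupoid"
  assumes "groupoid G" "subgroupoid K G"
  shows "groupoid (G\<lparr>arr := K\<rparr>)"
proof -
  interpret groupoid G by fact
  have K: "g \<in> arr G" "ginv G g \<in> K" if "g \<in> K" for g using assms(2) that by (auto simp: subgroupoid_def)
  have m: "mul G g h \<in> K" if "g \<in> K" "h \<in> K" "src G g = rng G h" for g h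
    using assms(2) that by (auto simp: subgroupoid_def)
  have s: "src G g \<in> K" if "g \<in> K" for g
    using m[OF K(2)[OF that] that] K(1)[OF that] by (simp add: src_ginv ginv_mul)
  have r: "rng G g \<in> K" if "g \<in> K" for g
    using m[OF that K(2)[OF that]] K(1)[OF that] by (simp add: rng_ginv mul_ginv)
  show ?thesis
    by unfold_locales
      (simp_all add: K m s r src_src rng_src src_rng rng_rng src_mul rng_mul mul_src rng_mul_self
        src_ginv rng_ginv ginv_mul mul_ginv mul_assoc)
qed

section \<open>Comparing the germ groupoids of a groupoid and of a subgroupoid\<close>

context self_similar_action
begin

text \<open>Only the carrier of \<open>G\<close> is changed, and the product of triples does not
  look at it, so both products are the same function.\<close>

lemma semigroup_mult_subgroupoid:
  assumes "self_similar_action (G\<lparr>arr := K\<rparr>) E act res"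
  shows "self_similar_action.semigroup_mult (G\<lparr>arr := K\<rparr>) act res = semigroup_mult"
proof (intro ext)
  interpret H: self_similar_action "G\<lparr>arr := K\<rparr>" E act res by fact
  fix a b
  show "H.semigroup_mult a b = semigroup_mult a b"
  proof (cases "\<exists>v p g u q v' p' h u' q'. a = Some ((v, p), g, (u, q)) \<and> b = Some ((v', p'), h, (u', q'))")
    case True
    then obtain v p g u q v' p' h u' q' where "a = Some ((v, p), g, (u, q))" "b = Some ((v', p'), h, (u', q'))"
      by blast
    moreover have "mul (G\<lparr>arr := K\<rparr>) = mul G" "ginv (G\<lparr>arr := K\<rparr>) = ginv G" by simp_all
    ultimately show ?thesis by (simp only: H.semigroup_mult.simps semigroup_mult.simps)
  next
    case False
    then have "a = None \<or> b = None" by (cases a; cases b) auto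
    then show ?thesis by (cases a) auto
  qed
qed

lemma src_germ: "(a, w) \<in> germ_pairs \<Longrightarrow> src germ_groupoid (germ a w) = germ_unit w"
  by (metis germ_pairsE std_def src_std)

lemma rng_germ: "(a, w) \<in> germ_pairs \<Longrightarrow> rng germ_groupoid (germ a w) = germ_unit (apply_triple a w)"
  by (metis germ_pairsE std_def rng_std)

lemma germ_unit_tri: "germ_unit w = germ (tri w 0 (head E (w 0)) w 0) w"
  by (simp add: germ_unit_def tri_def Let_def)

text \<open>
  Every germ of \<open>G\<close> is represented by an element whose group coordinate lies in \<open>K\<close>, so the
  isomorphism only has to restrict germs, which are sets of representatives.
\<close>

lemma germ_groupoid_subgroupoid_iso:
  assumes sub: "self_similar_action (G\<lparr>arr := K\<rparr>) E act res"
    and KG: "K \<subseteq> arr G"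
    and absorb: "\<And>g. g \<in> arr G \<Longrightarrow> \<exists>n. \<forall>p. edge_path (src G g) p \<and> n \<le> length p \<longrightarrow> res_path g p \<in> K"
  shows "top_groupoid_isomorphic germ_groupoid
    (self_similar_action.germ_groupoid (G\<lparr>arr := K\<rparr>) E act res)"
proof -
  interpret H: self_similar_action "G\<lparr>arr := K\<rparr>" E act res by fact
  note mult = semigroup_mult_subgroupoid[OF sub]
  have chart_H: "H.chart x i f w j \<longleftrightarrow> chart x i f w j \<and> f \<in> K" for x i f w j
    using KG by (auto simp: H.chart_def chart_def)
  have elems: "H.semigroup_elems \<subseteq> semigroup_elems"
    using KG unfolding H.semigroup_elems_def semigroup_elems_def by auto
  have pairs: "H.germ_pairs \<subseteq> germ_pairs"
    using elems unfolding H.germ_pairs_def germ_pairs_def by auto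
  have rel: "H.germ_rel = germ_rel \<inter> H.germ_pairs \<times> H.germ_pairs"
  proof (intro equalityI subrelI)
    fix p q assume pq: "(p, q) \<in> H.germ_rel"
    have "H.idempotents \<subseteq> idempotents"
      using elems unfolding H.idempotents_def idempotents_def mult by auto
    then show "(p, q) \<in> germ_rel \<inter> H.germ_pairs \<times> H.germ_pairs"
      using pq pairs unfolding H.germ_rel_def germ_rel_def mult by blast
  next
    fix p q assume "(p, q) \<in> germ_rel \<inter> H.germ_pairs \<times> H.germ_pairs"
    then obtain a b w e where pq: "p = (a, w)" "q = (b, w)" "p \<in> H.germ_pairs" "q \<in> H.germ_pairs"
      and e: "e \<in> idempotents" "w \<in> dom_of e" "semigroup_mult a e = semigroup_mult b e"
      unfolding germ_rel_def by blast
    \<comment> \<open>An idempotent has a unit as its coordinate, so a witness for \<open>G\<close>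
      is already one for \<open>K\<close>.\<close>
    obtain n where "w \<in> infinite_paths" "e = tri w n (head E (w n)) w n" using idem_cases[OF e(1,2)] .
    then have "e \<in> H.idempotents" using H.idem_tri(1) by simp
    then show "(p, q) \<in> H.germ_rel" unfolding H.germ_rel_def mult using pq e by blast
  qed
  define \<phi> where "\<phi> X = X \<inter> H.germ_pairs" for X :: "('g, 'e) germ"
  have phi: "\<phi> (germ a w) = H.germ a w" if "(a, w) \<in> H.germ_pairs" for a w
    unfolding \<phi>_def germ_def H.germ_def rel using that by blast
  \<comment> \<open>Restricting along \<open>n\<close> more letters brings the coordinate into
    \<open>K\<close> without changing the germ.\<close>
  have rep: "\<exists>a w. (a, w) \<in> H.germ_pairs \<and> X = germ a w" if X: "X \<in> arr germ_groupoid" for X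
  proof -
    obtain x i f w j where c: "chart x i f w j" "X = std x i f w j" using X by (rule germ_arrE)
    then have "f \<in> arr G" by (simp add: chart_def)
    then obtain n where n: "\<And>p. edge_path (src G f) p \<Longrightarrow> n \<le> length p \<Longrightarrow> res_path f p \<in> K"
      using absorb by blast
    have jn: "j \<le> j + n" by simp
    have "res_path f (subsequence w j (j + n)) \<in> K" by (rule n[OF edge_path_chart[OF c(1) jn]]) simp
    then have "H.chart x (i + n) (res_path f (subsequence w j (j + n))) w (j + n)"
      unfolding chart_H using chart_bump[OF c(1) jn] by simp
    moreover have "X = std x (i + n) (res_path f (subsequence w j (j + n))) w (j + n)"
      using std_bump[OF c(1) jn] c(2) by simp
    ultimately show ?thesis using H.tri_germ_pairs unfolding std_def by blast
  qed
  have inj: "inj_on \<phi> (arr germ_groupoid)"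
  proof (rule inj_onI)
    fix X Y assume "X \<in> arr germ_groupoid" "Y \<in> arr germ_groupoid" and eq: "\<phi> X = \<phi> Y"
    then obtain a w b z where X: "(a, w) \<in> H.germ_pairs" "X = germ a w"
      and Y: "(b, z) \<in> H.germ_pairs" "Y = germ b z" using rep by meson
    have "((a, w), (b, z)) \<in> germ_rel"
      using eq X Y phi H.germ_eq_iff[OF X(1) Y(1)] rel by auto
    moreover have "(a, w) \<in> germ_pairs" "(b, z) \<in> germ_pairs" using X Y pairs by auto
    ultimately show "X = Y" using X Y germ_eq_iff by simp
  qed
  have image: "\<phi> ` arr germ_groupoid = arr H.germ_groupoid"
  proof (intro equalityI subsetI)
    fix Y assume "Y \<in> \<phi> ` arr germ_groupoid"
    then show "Y \<in> arr H.germ_groupoid" using rep phi H.germ_arr by auto metis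
  next
    fix Y assume "Y \<in> arr H.germ_groupoid"
    then obtain x i f w j where c: "H.chart x i f w j" "Y = H.std x i f w j" by (rule H.germ_arrE)
    then have "(tri x i f w j, w) \<in> H.germ_pairs" "Y = H.germ (tri x i f w j) w"
      using H.tri_germ_pairs by (auto simp: H.std_def)
    then have "Y = \<phi> (germ (tri x i f w j) w)" "germ (tri x i f w j) w \<in> arr germ_groupoid"
      using phi germ_arr[OF subsetD[OF pairs]] by simp_all
    then show "Y \<in> \<phi> ` arr germ_groupoid" by (rule image_eqI)
  qed
  have unit: "\<phi> (germ_unit w) = H.germ_unit w" if "w \<in> infinite_paths" for w
    unfolding germ_unit_tri H.germ_unit_tri
    by (rule phi) (rule H.tri_germ_pairs[OF H.chart_unit[OF that]])
  have inf: "w \<in> infinite_paths" "apply_triple a w \<in> infinite_paths" if "(a, w) \<in> germ_pairs" for a w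
    using germ_pairsE[OF that] unfolding chart_def by metis+
  have srcrng: "src H.germ_groupoid (\<phi> X) = \<phi> (src germ_groupoid X) \<and>
      rng H.germ_groupoid (\<phi> X) = \<phi> (rng germ_groupoid X)" if X: "X \<in> arr germ_groupoid" for X
  proof -
    obtain a w where a: "(a, w) \<in> H.germ_pairs" "X = germ a w" using rep[OF X] by blast
    have "(a, w) \<in> germ_pairs" using a pairs by auto
    then show ?thesis
      using a phi[OF a(1)] H.src_germ[OF a(1)] H.rng_germ[OF a(1)] src_germ rng_germ unit inf by simp
  qed
  have mul: "\<phi> (mul germ_groupoid X Y) = mul H.germ_groupoid (\<phi> X) (\<phi> Y)"
    if X: "X \<in> arr germ_groupoid" and Y: "Y \<in> arr germ_groupoid"
      and XY: "src germ_groupoid X = rng germ_groupoid Y" for X Y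
  proof -
    obtain a y where a: "(a, y) \<in> H.germ_pairs" "X = germ a y" using rep[OF X] by blast
    obtain b w where b: "(b, w) \<in> H.germ_pairs" "Y = germ b w" using rep[OF Y] by blast
    have ab: "(a, y) \<in> germ_pairs" "(b, w) \<in> germ_pairs" using a b pairs by auto
    have y: "y = apply_triple b w"
      using XY a b src_germ[OF ab(1)] rng_germ[OF ab(2)] germ_unit_inject inf ab by simp
    show ?thesis
      using mul_germ(1)[of a b w] H.mul_germ[of a b w] phi ab a b unfolding y mult by simp
  qed
  \<comment> \<open>Openness on either side is tested by fixing a triple and varying the point. A
    triple with coordinate in \<open>K\<close> serves for both groupoids, and \<open>\<phi>\<close>
    matches its germs.\<close>
  have "homeomorphic_map (gtop germ_groupoid) (gtop H.germ_groupoid) \<phi>"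
  proof (rule bijective_open_imp_homeomorphic_map)
    show "continuous_map (gtop germ_groupoid) (gtop H.germ_groupoid) \<phi>"
      unfolding continuous_map_def topspace_germ_groupoid H.topspace_germ_groupoid
    proof (intro conjI allI impI)
      show "\<phi> \<in> arr germ_groupoid \<rightarrow> arr H.germ_groupoid" using image by blast
      fix V assume V: "openin (gtop H.germ_groupoid) V"
      show "openin (gtop germ_groupoid) {X \<in> arr germ_groupoid. \<phi> X \<in> V}"
      proof (rule openin_germ_groupoidI)
        fix X assume X: "X \<in> {X \<in> arr germ_groupoid. \<phi> X \<in> V}"
        then obtain a w where a: "(a, w) \<in> H.germ_pairs" "X = germ a w" using rep by blast
        have "H.germ a w \<in> V" using X a phi by simp
        then obtain n where n: "\<And>z. z \<in> infinite_paths \<Longrightarrow> prefix n z = prefix n w \<Longrightarrow>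
            (a, z) \<in> H.germ_pairs \<and> H.germ a z \<in> V"
          using H.openin_germ_groupoid_local[OF V a(1)] by blast
        have "germ a z \<in> {X \<in> arr germ_groupoid. \<phi> X \<in> V}"
          if "(a, z) \<in> germ_pairs" "prefix n z = prefix n w" for z
          using n[OF inf(1)[OF that(1)] that(2)] phi germ_arr[OF that(1)] by simp
        then show "\<exists>a w n. (a, w) \<in> germ_pairs \<and> X = germ a w \<and> (\<forall>z. (a, z) \<in> germ_pairs \<and>
            prefix n z = prefix n w \<longrightarrow> germ a z \<in> {X \<in> arr germ_groupoid. \<phi> X \<in> V})"
          using a pairs by blast
      qed
    qed
    show "open_map (gtop germ_groupoid) (gtop H.germ_groupoid) \<phi>"
      unfolding open_map_def
    proof (intro allI impI)
      fix V assume V: "openin (gtop germ_groupoid) V"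
      show "openin (gtop H.germ_groupoid) (\<phi> ` V)"
      proof (rule H.openin_germ_groupoidI)
        fix Y assume "Y \<in> \<phi> ` V"
        then obtain X where X: "X \<in> V" "Y = \<phi> X" by blast
        then have "X \<in> arr germ_groupoid" using openin_subset[OF V] topspace_germ_groupoid by auto
        then obtain a w where a: "(a, w) \<in> H.germ_pairs" "X = germ a w" using rep by blast
        obtain n where n: "\<And>z. z \<in> infinite_paths \<Longrightarrow> prefix n z = prefix n w \<Longrightarrow>
            (a, z) \<in> germ_pairs \<and> germ a z \<in> V"
          using openin_germ_groupoid_local[OF V, of a w] a X pairs by blast
        have "H.germ a z \<in> \<phi> ` V" if z: "(a, z) \<in> H.germ_pairs" "prefix n z = prefix n w" for z
        proof -
          have "germ a z \<in> V" using n[OF inf(1)[OF subsetD[OF pairs z(1)]] z(2)] by blast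
          then show ?thesis unfolding phi[OF z(1), symmetric] by (rule imageI)
        qed
        then show "\<exists>a w n. (a, w) \<in> H.germ_pairs \<and> Y = H.germ a w \<and> (\<forall>z. (a, z) \<in> H.germ_pairs \<and>
            prefix n z = prefix n w \<longrightarrow> H.germ a z \<in> \<phi> ` V)"
          using a X phi by blast
      qed
    qed
  qed (simp_all add: topspace_germ_groupoid H.topspace_germ_groupoid image inj)
  then have "top_groupoid_iso germ_groupoid H.germ_groupoid \<phi>"
    unfolding top_groupoid_iso_def
    by (intro conjI bij_betw_imageI[OF inj image] ballI impI srcrng mul)
  then show ?thesis unfolding top_groupoid_isomorphic_def by blast
qed

end

section \<open>Self-similarity and generators of the nucleus subgroupoid\<close>

context contracting_self_similar_action
begin

text \<open>If \<open>g\<close> is not a restriction \<open>h|\<^sub>p\<close> for arbitrarily long \<open>p\<close>, it can be removed from the core.\<close>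

lemma res_nucleus:
  assumes g: "g \<in> nucleus" and e: "e \<in> arcs E" "src G g = head E e"
  shows "res g e \<in> nucleus"
proof -
  have core: "contracting_core nucleus" by (rule nucleus_least(1)[OF contracting])
  then have lvl: "\<exists>n. \<forall>p. edge_path (src G h) p \<and> n \<le> length p \<longrightarrow> res_path h p \<in> nucleus" if "h \<in> arr G" for h
    using that unfolding contracting_core_def by blast
  have "\<exists>h\<in>arr G. \<forall>n. \<exists>p. edge_path (src G h) p \<and> n \<le> length p \<and> res_path h p = g"
  proof (rule ccontr)
    assume "\<not> ?thesis"
    then have no: "\<exists>n. \<forall>p. edge_path (src G h) p \<and> n \<le> length p \<longrightarrow> res_path h p \<noteq> g" if "h \<in> arr G" for h
      using that by blast
    have "contracting_core (nucleus - {g})"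
      unfolding contracting_core_def
    proof (intro conjI ballI)
      fix h assume h: "h \<in> arr G"
      obtain n where n: "\<And>p. edge_path (src G h) p \<Longrightarrow> n \<le> length p \<Longrightarrow> res_path h p \<in> nucleus"
        using lvl[OF h] by blast
      obtain n' where n': "\<And>p. edge_path (src G h) p \<Longrightarrow> n' \<le> length p \<Longrightarrow> res_path h p \<noteq> g"
        using no[OF h] by blast
      show "\<exists>n. \<forall>p. edge_path (src G h) p \<and> n \<le> length p \<longrightarrow> res_path h p \<in> nucleus - {g}"
        by (rule exI[of _ "max n n'"]) (use n n' in auto)
    qed (use core in \<open>auto simp: contracting_core_def\<close>)
    then show False using nucleus_least(2)[OF contracting] g by blast
  qed
  then obtain h where h: "h \<in> arr G" "\<And>n. \<exists>p. edge_path (src G h) p \<and> n \<le> length p \<and> res_path h p = g"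
    by blast
  obtain n where n: "\<And>p. edge_path (src G h) p \<Longrightarrow> n \<le> length p \<Longrightarrow> res_path h p \<in> nucleus"
    using lvl[OF h(1)] by blast
  obtain p where p: "edge_path (src G h) p" "n \<le> length p" "res_path h p = g" using h(2) by blast
  \<comment> \<open>The path \<open>p\<close> is already beyond the contraction level of
    \<open>h\<close>, so appending \<open>e\<close> stays beyond it, and the restriction of
    \<open>h\<close> there is that of \<open>g\<close> at \<open>e\<close>.\<close>
  have "edge_path (src G h) (p @ [e])"
    using p e src_res_path[OF h(1) p(1)] tail_in_units[OF e(1)]
    by (simp add: edge_path_append verts_eq_units)
  then have "res_path h (p @ [e]) \<in> nucleus" using n p by simp
  then show ?thesis using p by (simp add: res_path_append)
qed

text \<open>The arrows of \<open>K\<close> whose restrictions at all edges lie in \<open>K\<close>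
  form a subgroupoid. It contains the generators by \<open>res_unit\<close> and
  \<open>res_nucleus\<close>, so by minimality it is all of \<open>K\<close>.\<close>

lemma self_similar_nucleus_subgroupoid: "self_similar_action nucleus_subgroupoid E act res"
  and arr_nucleus_subgroupoid: "arr nucleus_subgroupoid \<subseteq> arr G" "units G \<union> nucleus \<subseteq> arr nucleus_subgroupoid"
proof -
  define K where "K = generated_subgroupoid G (units G \<union> nucleus)"
  have H: "nucleus_subgroupoid = G\<lparr>arr := K\<rparr>" by (simp add: nucleus_subgroupoid_def K_def)
  have "nucleus \<subseteq> arr G" using nucleus_least(1)[OF contracting] by (simp add: contracting_core_def)
  then have A: "units G \<union> nucleus \<subseteq> arr G" using units_arr by auto
  note K = subgroupoid_generated[OF groupoid_axioms A, folded K_def]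
  have KG: "g \<in> arr G" "ginv G g \<in> K" if "g \<in> K" for g using K(1) that by (auto simp: subgroupoid_def)
  have Km: "mul G g h \<in> K" if "g \<in> K" "h \<in> K" "src G g = rng G h" for g h
    using K(1) that by (auto simp: subgroupoid_def)
  have "subgroupoid {g \<in> K. \<forall>e\<in>arcs E. src G g = head E e \<longrightarrow> res g e \<in> K} G"
    unfolding subgroupoid_def
  proof (intro conjI ballI impI)
    fix g assume g: "g \<in> {g \<in> K. \<forall>e\<in>arcs E. src G g = head E e \<longrightarrow> res g e \<in> K}"
    have ga: "g \<in> arr G" using g KG by auto
    have "res (ginv G g) e \<in> K" if e: "e \<in> arcs E" "src G (ginv G g) = head E e" for e
    proof -
      \<comment> \<open>With \<open>d\<close> the preimage of \<open>e\<close> under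
        \<open>g\<close>, the restriction of the inverse at \<open>e\<close> is the inverse of the
        restriction of \<open>g\<close> at \<open>d\<close>.\<close>
      define d where "d = act (ginv G g) e"
      have gi: "ginv G g \<in> arr G" using ga by (rule ginv_closed)
      have d: "d \<in> arcs E" "head E d = src G g" "act g d = e"
        using act_closed[OF gi e] head_act[OF gi e] act_mul[OF ga gi e(1)] e act_unit ga
        by (simp_all add: d_def rng_ginv src_ginv mul_ginv)
      have "res_path (ginv G g) (act_path g [d]) = ginv G (res_path g [d])"
        by (rule res_path_ginv) (use ga d tail_in_units in \<open>auto simp: verts_eq_units\<close>)
      then have "res (ginv G g) e = ginv G (res g d)" using d by simp
      then show ?thesis using g d KG by simp
    qed
    then show "ginv G g \<in> {g \<in> K. \<forall>e\<in>arcs E. src G g = head E e \<longrightarrow> res g e \<in> K}" using g KG by simp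
  next
    fix g h assume g: "g \<in> {g \<in> K. \<forall>e\<in>arcs E. src G g = head E e \<longrightarrow> res g e \<in> K}"
      and h: "h \<in> {g \<in> K. \<forall>e\<in>arcs E. src G g = head E e \<longrightarrow> res g e \<in> K}" and gh: "src G g = rng G h"
    have a: "g \<in> arr G" "h \<in> arr G" using g h KG by auto
    have "res (mul G g h) e \<in> K" if e: "e \<in> arcs E" "src G h = head E e" for e
      using g h gh e a res_mul[OF a e(1) gh e(2)]
      by (auto intro!: Km simp: act_closed head_act src_res rng_res)
    then show "mul G g h \<in> {g \<in> K. \<forall>e\<in>arcs E. src G g = head E e \<longrightarrow> res g e \<in> K}"
      using g h gh Km a by (simp add: src_mul)
  qed (use KG in auto)
  moreover have "units G \<union> nucleus \<subseteq> {g \<in> K. \<forall>e\<in>arcs E. src G g = head E e \<longrightarrow> res g e \<in> K}"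
    using K(2) res_nucleus res_unit tail_in_units by (auto simp: src_unit)
  ultimately have res_K: "res g e \<in> K" if "g \<in> K" "e \<in> arcs E" "src G g = head E e" for g e
    using generated_subgroupoid_least that unfolding K_def by blast
  interpret H: groupoid "G\<lparr>arr := K\<rparr>" by (rule groupoid_subgroupoid[OF groupoid_axioms K(1)])
  have uH: "units (G\<lparr>arr := K\<rparr>) = units G"
  proof
    show "units (G\<lparr>arr := K\<rparr>) \<subseteq> units G" using KG by (auto simp: units_def)
    show "units G \<subseteq> units (G\<lparr>arr := K\<rparr>)"
    proof
      fix u assume "u \<in> units G"
      then have "u \<in> K" "src G u = u" using K(2) src_unit by auto
      then show "u \<in> units (G\<lparr>arr := K\<rparr>)" using image_eqI[of u "src G" u K] by (simp add: units_def)
    qed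
  qed
  show "self_similar_action nucleus_subgroupoid E act res"
    unfolding H
    by unfold_locales
      (simp_all add: uH verts_eq_units KG act_closed head_act act_unit act_mul res_K rng_res src_res res_mul)
  show "arr nucleus_subgroupoid \<subseteq> arr G" "units G \<union> nucleus \<subseteq> arr nucleus_subgroupoid"
    using KG K(2) by (auto simp: H)
qed

text \<open>The nucleus of \<open>G\<close> lies in the subgroupoid and restrictions are computed as
  before, so it is a contracting core there as well.\<close>

lemma contracting_nucleus_subgroupoid: "contracting_self_similar_action nucleus_subgroupoid E act res"
proof -
  interpret H: self_similar_action nucleus_subgroupoid E act res by (rule self_similar_nucleus_subgroupoid)
  have "src nucleus_subgroupoid = src G" by (simp add: nucleus_subgroupoid_def)
  then have "H.contracting_core nucleus"
    using nucleus_least(1)[OF contracting] arr_nucleus_subgroupoid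
    unfolding H.contracting_core_def contracting_core_def by auto
  then have "H.contracting" unfolding H.contracting_def by blast
  then show ?thesis using no_sources by unfold_locales
qed

text \<open>A subgroupoid of the nucleus subgroupoid is also one of \<open>G\<close>, so generating
  inside the smaller groupoid gives nothing smaller. The units are the finitely many
  vertices.\<close>

lemma finitely_generated_nucleus_subgroupoid: "finitely_generated nucleus_subgroupoid"
  unfolding finitely_generated_def
proof (intro exI conjI)
  interpret H: self_similar_action nucleus_subgroupoid E act res by (rule self_similar_nucleus_subgroupoid)
  show "finite (units G \<union> nucleus)"
    using finite_verts verts_eq_units nucleus_least(1)[OF contracting] by (simp add: contracting_core_def)
  show *: "units G \<union> nucleus \<subseteq> arr nucleus_subgroupoid" by (rule arr_nucleus_subgroupoid)
  note gen = subgroupoid_generated[OF H.groupoid_axioms *]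
  have "subgroupoid (generated_subgroupoid nucleus_subgroupoid (units G \<union> nucleus)) G"
    using gen(1) arr_nucleus_subgroupoid(1) by (auto simp: subgroupoid_def nucleus_subgroupoid_def)
  then have "arr nucleus_subgroupoid \<subseteq> generated_subgroupoid nucleus_subgroupoid (units G \<union> nucleus)"
    using generated_subgroupoid_least[OF _ gen(2)] by (simp add: nucleus_subgroupoid_def)
  then show "generated_subgroupoid nucleus_subgroupoid (units G \<union> nucleus) = arr nucleus_subgroupoid"
    using gen(1) by (auto simp: subgroupoid_def)
qed

lemma germ_groupoid_nucleus_subgroupoid_iso:
  "top_groupoid_isomorphic germ_groupoid
    (self_similar_action.germ_groupoid nucleus_subgroupoid E act res)"
proof -
  define K where "K = arr nucleus_subgroupoid"
  have H: "nucleus_subgroupoid = G\<lparr>arr := K\<rparr>" by (simp add: nucleus_subgroupoid_def K_def)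
  have K: "K \<subseteq> arr G" "nucleus \<subseteq> K" using arr_nucleus_subgroupoid by (auto simp: K_def)
  show ?thesis
    unfolding H
  proof (rule germ_groupoid_subgroupoid_iso)
    show "self_similar_action (G\<lparr>arr := K\<rparr>) E act res"
      using self_similar_nucleus_subgroupoid unfolding H .
    show "\<exists>n. \<forall>p. edge_path (src G g) p \<and> n \<le> length p \<longrightarrow> res_path g p \<in> K" if "g \<in> arr G" for g
      using nucleus_least(1)[OF contracting] that K(2) unfolding contracting_core_def by blast
  qed (rule K)
qed

end

theorem corollary2p19:
  fixes G :: "'g groupoid" and E :: "('g, 'e) pre_digraph"
    and act :: "'g \<Rightarrow> 'e \<Rightarrow> 'e" and res :: "'g \<Rightarrow> 'e \<Rightarrow> 'g"
  assumes "contracting_self_similar_action G E act res"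
  shows "amenable (self_similar_action.germ_groupoid G E act res) \<and>
    (let H = self_similar_action.nucleus_subgroupoid G E res in
       contracting_self_similar_action H E act res \<and>
       finitely_generated H \<and>
       top_groupoid_isomorphic
         (self_similar_action.germ_groupoid G E act res)
         (self_similar_action.germ_groupoid H E act res))"
proof -
  interpret contracting_self_similar_action G E act res by fact
  show ?thesis
    unfolding Let_def
    using amenable_germ_groupoid contracting_nucleus_subgroupoid
      finitely_generated_nucleus_subgroupoid germ_groupoid_nucleus_subgroupoid_iso by blast
qed

end
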